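(* Let $G=(V,E)$ be a connected Eulerian directed graph (i.e. $\deg^+(v)=\deg^-(v)$ for all $v\in V$; loops and multiple edges allowed) and let $s\in V$. Then the Biggs-Merino polynomial $B(G,s;y)$ equals the greedoid Tutte polynomial $T(G,s;y)$.
   Context: $\deg^+(v)$ is the outdegree of $v$. Sandpile model with sink $s$: an $s$-configuration is $\hat{\mathbf c}\in\mathbb N_0^{V\setminus\{s\}}$. Firing a vertex $v\neq s$ removes $\deg^+(v)$ chips from $v$ and sends one chip along each outgoing edge of $v$ to its target (a loop returns its chip to $v$); chips sent to $s$ disappear. The firing is legal if $\hat{\mathbf c}(v)\ge \deg^+(v)$. $\hat{\mathbf c}$ is stable if $\hat{\mathbf c}(v)<\deg^+(v)$ for all $v\ne s$. Every $s$-configuration $\hat{\mathbf c}$ reaches, by a finite sequence of legal firings, a unique stable $s$-configuration $\hat{\mathbf c}^\circ$. An $s$-configuration $\hat{\mathbf c}$ is $s$-recurrent if for every $s$-configuration $\hat{\mathbf c}_1$ there is an $s$-configuration $\hat{\mathbf c}_2$ with $(\hat{\mathbf c}_1+\hat{\mathbf c}_2)^\circ=\hat{\mathbf c}$; $\mathrm{Rec}(G,s)$ is the set of these. Let $\mathbf u_s\in\mathbb N_0^{V\setminus\{s\}}$ with $\mathbf u_s(v)$ the number of edges from $s$ to $v$. On $\mathrm{Rec}(G,s)$ define $\hat{\mathbf c}\overset{s}{\sim}\hat{\mathbf d}$ iff $\hat{\mathbf d}=(\hat{\mathbf c}+k\mathbf u_s)^\circ$ for some $k\in\mathbb N_0$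 (an equivalence relation); $\mathrm{Rec}(G,\overset{s}{\sim})$ is the set of classes. The d-level of $\hat{\mathbf c}$ is $\mathrm{dlvl}(\hat{\mathbf c})=\deg^+(s)+\sum_{v\neq s}\hat{\mathbf c}(v)$, the d-level of a class is the maximum d-level of its elements, and $B(G,s;y)=\sum_{[\hat{\mathbf c}]\in \mathrm{Rec}(G,\overset{s}{\sim})}y^{\mathrm{dlvl}([\hat{\mathbf c}])}$. Greedoid Tutte polynomial: fix a total order $<$ on $E$. A directed path of length $k\ge 0$ is $v_0e_0v_1\dots e_{k-1}v_k$ with pairwise distinct vertices and $e_i$ an edge from $v_i$ to $v_{i+1}$. An arborescence rooted at $s$ is a subgraph $T$ with vertex set $V$ such that for every $v\in V$ there is a unique directed path in $T$ from $s$ to $v$; $A(G,s)$ denotes the set of these. For an edge $e\notin E(T)$ there are exactly two edge-disjoint directed paths $P_1,P_2$ in $(V,E(T)\cup\{e\})$ having the same starting vertex and both ending at the target of $e$, with $P_1$ the one containing $e$; $e$ is externally active in $T$ if the $<$-smallest edge of $E(P_1)\cup E(P_2)$ lies in $P_1$. $e(T)$ is the number of externally active edges of $T$, and $T(G,s;y)=\sum_{T\in A(G,s)}y^{e(T)}$ (this does not depend on the chosen order).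
   Formalization: Arborescences are also required to have no directed cycle (unique paths alone would admit extra edges into ancestors, making the claim false), and P1 may be a closed cycle at the target of e with P2 of length 0 when that target is an ancestor of e's source or e is a loop. *)

theory Defs
  imports "HOL-Computational_Algebra.Polynomial" "Graph_Theory.Graph_Theory"
begin

definition num_arcs :: "('v, 'e) pre_digraph \<Rightarrow> 'v \<Rightarrow> 'v \<Rightarrow> nat" where
  "num_arcs G v w = card {e \<in> arcs G. tail G e = v \<and> head G e = w}"

definition eulerian :: "('v, 'e) pre_digraph \<Rightarrow> bool" where
  "eulerian G \<longleftrightarrow> (\<forall>v \<in> verts G. out_degree G v = in_degree G v)"


section \<open>The sandpile model\<close>

text \<open>
  Elements of \<open>\<nat>\<^bsup>V - {s}\<^esup>\<close> are represented by functions on the whole vertex type that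
  vanish outside \<open>V - {s}\<close>, so that equality of configurations is equality of functions.
\<close>

definition configs :: "('v, 'e) pre_digraph \<Rightarrow> 'v \<Rightarrow> ('v \<Rightarrow> nat) set" where
  "configs G s = {c. \<forall>v. v \<notin> verts G - {s} \<longrightarrow> c v = 0}"

definition fire :: "('v, 'e) pre_digraph \<Rightarrow> 'v \<Rightarrow> 'v \<Rightarrow> ('v \<Rightarrow> nat) \<Rightarrow> ('v \<Rightarrow> nat)" where
  "fire G s v c = (\<lambda>w. if w \<in> verts G - {s}
     then (if w = v then c w - out_degree G v else c w) + num_arcs G v w else 0)"

definition legal_firing :: "('v, 'e) pre_digraph \<Rightarrow> 'v \<Rightarrow> ('v \<Rightarrow> nat) \<Rightarrow> ('v \<Rightarrow> nat) \<Rightarrow> bool" where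
  "legal_firing G s c d \<longleftrightarrow> (\<exists>v \<in> verts G - {s}. out_degree G v \<le> c v \<and> d = fire G s v c)"

definition stable :: "('v, 'e) pre_digraph \<Rightarrow> 'v \<Rightarrow> ('v \<Rightarrow> nat) \<Rightarrow> bool" where
  "stable G s c \<longleftrightarrow> (\<forall>v \<in> verts G - {s}. c v < out_degree G v)"

definition stabilization :: "('v, 'e) pre_digraph \<Rightarrow> 'v \<Rightarrow> ('v \<Rightarrow> nat) \<Rightarrow> ('v \<Rightarrow> nat)" where
  "stabilization G s c = (THE d. (legal_firing G s)\<^sup>*\<^sup>* c d \<and> stable G s d)"

definition Rec :: "('v, 'e) pre_digraph \<Rightarrow> 'v \<Rightarrow> ('v \<Rightarrow> nat) set" where
  "Rec G s = {c \<in> configs G s. \<forall>c1 \<in> configs G s. \<exists>c2 \<in> configs G s.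
     stabilization G s (\<lambda>v. c1 v + c2 v) = c}"

definition source_config :: "('v, 'e) pre_digraph \<Rightarrow> 'v \<Rightarrow> ('v \<Rightarrow> nat)" where
  "source_config G s = (\<lambda>v. if v \<in> verts G - {s} then num_arcs G s v else 0)"

definition rec_rel :: "('v, 'e) pre_digraph \<Rightarrow> 'v \<Rightarrow> ('v \<Rightarrow> nat) rel" where
  "rec_rel G s = {(c, d). c \<in> Rec G s \<and> d \<in> Rec G s \<and>
     (\<exists>k. d = stabilization G s (\<lambda>v. c v + k * source_config G s v))}"

definition dlvl :: "('v, 'e) pre_digraph \<Rightarrow> 'v \<Rightarrow> ('v \<Rightarrow> nat) \<Rightarrow> nat" where
  "dlvl G s c = out_degree G s + (\<Sum>v \<in> verts G - {s}. c v)"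

definition class_dlvl :: "('v, 'e) pre_digraph \<Rightarrow> 'v \<Rightarrow> ('v \<Rightarrow> nat) set \<Rightarrow> nat" where
  "class_dlvl G s C = Max (dlvl G s ` C)"

definition biggs_merino_poly :: "('v, 'e) pre_digraph \<Rightarrow> 'v \<Rightarrow> int poly" where
  "biggs_merino_poly G s = (\<Sum>C \<in> Rec G s // rec_rel G s. monom 1 (class_dlvl G s C))"


section \<open>The greedoid Tutte polynomial\<close>

text \<open>
  Paths (\<^const>\<open>pre_digraph.apath\<close>) have pairwise distinct vertices, so an arc into an ancestor
  (in particular a loop) never lies on a path from the root, and uniqueness of these paths alone
  does not exclude such arcs from \<open>T\<close>; acyclicity (\<^const>\<open>forest\<close>) does.
\<close>

definition arborescence :: "('v, 'e) pre_digraph \<Rightarrow> 'v \<Rightarrow> ('v, 'e) pre_digraph \<Rightarrow> bool" where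
  "arborescence G s T \<longleftrightarrow> spanning T G \<and> forest T \<and>
     (\<forall>v \<in> verts G. \<exists>!p. pre_digraph.apath T s p v)"

text \<open>
  If the target of \<open>e\<close> is an ancestor in \<open>T\<close> of its source (in particular if \<open>e\<close> is a loop),
  then the common starting vertex of \<open>P1\<close> and \<open>P2\<close> is the target of \<open>e\<close> itself: \<open>P2\<close> is the
  path of length 0 and \<open>P1\<close> is the cycle formed by \<open>e\<close> and the path in \<open>T\<close>. Hence \<open>P1\<close> may be
  closed. The relation \<open>r\<close> is the reflexive form of the order on the arcs.
\<close>

definition path_pair ::
  "('v, 'e) pre_digraph \<Rightarrow> 'e \<Rightarrow> 'v \<Rightarrow> 'e awalk \<Rightarrow> 'e awalk \<Rightarrow> bool" where
  "path_pair T e u P1 P2 \<longleftrightarrow>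
     (let H = pre_digraph.add_arc T e; w = head T e in
       (pre_digraph.apath H u P1 w \<or>
         u = w \<and> pre_digraph.awalk H u P1 w \<and> pre_digraph.cycle H P1) \<and>
       pre_digraph.apath H u P2 w \<and> e \<in> set P1 \<and> set P1 \<inter> set P2 = {})"

definition externally_active ::
  "'e rel \<Rightarrow> ('v, 'e) pre_digraph \<Rightarrow> ('v, 'e) pre_digraph \<Rightarrow> 'e \<Rightarrow> bool" where
  "externally_active r G T e \<longleftrightarrow> e \<in> arcs G - arcs T \<and>
     (\<exists>u P1 P2. path_pair T e u P1 P2 \<and>
       (\<exists>f \<in> set P1. \<forall>g \<in> set P1 \<union> set P2. (f, g) \<in> r))"

definition ext_activity ::
  "'e rel \<Rightarrow> ('v, 'e) pre_digraph \<Rightarrow> ('v, 'e) pre_digraph \<Rightarrow> nat" where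
  "ext_activity r G T = card {e. externally_active r G T e}"

definition greedoid_tutte_poly :: "'e rel \<Rightarrow> ('v, 'e) pre_digraph \<Rightarrow> 'v \<Rightarrow> int poly" where
  "greedoid_tutte_poly r G s = (\<Sum>T | arborescence G s T. monom 1 (ext_activity r G T))"

end

theory Submission
  imports Defs
begin

text \<open>
  In an Eulerian digraph the burning algorithm shows \<open>(c + u\<^sub>s)\<^sup>\<circ> = c\<close> for recurrent \<open>c\<close>, so the
  equivalence relation on recurrent configurations is equality, and \<open>c \<mapsto> deg - 1 - c\<close> identifies
  them with the parking functions \<open>p\<close> based at \<open>s\<close>; the d-level becomes \<open>|E| - (|V| - 1) - \<Sum>p\<close>.
  It remains to show that the sum of a parking function is distributed like the number of externally
  inactive arcs of an arborescence. Both sides satisfy the same deletion-contraction recursion at the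
  largest arc \<open>e\<close> from the root to some \<open>v\<close>: if \<open>e \<notin> T\<close> then \<open>e\<close> is inactive, which matches
  decreasing a positive \<open>p v\<close>; if \<open>e \<in> T\<close> then \<open>e\<close> is never the smallest arc that decides an
  activity, so it may be contracted, which matches \<open>p v = 0\<close>.
\<close>

section \<open>Deletion and contraction\<close>

text \<open>Why the largest root arc \<open>e\<close> never decides an activity: the path to the
  head of an arc \<open>x\<close>, and the path to its tail followed by \<open>x\<close>, start with
  arcs leaving the root set, unless the former is empty. If \<open>e\<close> starts only one of
  them, the other starts with a smaller root arc; if the path to the head is empty, it cannot hold
  the minimum anyway. A literal contraction would change vertices, tails and heads. Here the graph
  stays fixed, and a pair \<open>B\<close>, \<open>X\<close> records the vertices merged into the
  root and the arcs still alive. Ancestor sets replace paths: a common initial segment cancels in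
  set differences. Inactive arcs are counted, not active ones, because arcs left over when
  everything is contracted (loops, for instance) are all active and so need no counterpart in a
  parking function. On the sandpile side, balance makes burning a closed cycle: once the chips of
  \<open>s\<close> are added, every other vertex fires exactly once and gets back in total what it
  lost.\<close>

definition min_in :: "'a rel \<Rightarrow> 'a set \<Rightarrow> 'a set \<Rightarrow> bool" where
  "min_in r P Q \<longleftrightarrow> (\<exists>m\<in>P. \<forall>g\<in>P \<union> Q. (m, g) \<in> r)"

text \<open>Since \<open>f\<close> lies below \<open>e\<close>, the arc \<open>e\<close> is never
  the minimum of the union, so dropping it does not move the minimum.\<close>

lemma min_in_remove:
  assumes "antisym r" "trans r" "f \<in> P \<union> Q" "f \<noteq> e" "(f, e) \<in> r"
  shows "min_in r (P - {e}) (Q - {e}) \<longleftrightarrow> min_in r P Q"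
proof
  assume "min_in r (P - {e}) (Q - {e})"
  then obtain m where m: "m \<in> P" "\<forall>g\<in>(P \<union> Q) - {e}. (m, g) \<in> r"
    unfolding min_in_def by blast
  with assms have "(m, e) \<in> r" by (meson DiffI singletonD transD)
  with m show "min_in r P Q" unfolding min_in_def by blast
next
  assume "min_in r P Q"
  then obtain m where m: "m \<in> P" "\<forall>g\<in>P \<union> Q. (m, g) \<in> r" unfolding min_in_def by blast
  with assms have "m \<noteq> e" by (metis antisymD)
  with m show "min_in r (P - {e}) (Q - {e})" unfolding min_in_def by blast
qed

lemma linear_order_on_finite_min:
  assumes "linear_order_on A r" "finite S" "S \<noteq> {}" "S \<subseteq> A"
  shows "\<exists>m\<in>S. \<forall>g\<in>S. (m, g) \<in> r"
  using assms(2-4)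
proof (induction rule: finite_ne_induct)
  case (singleton x)
  then show ?case using assms(1)
    by (auto simp: order_on_defs refl_on_def)
next
  case (insert x F)
  then obtain m where m: "m \<in> F" "\<forall>g\<in>F. (m, g) \<in> r" by blast
  have tr: "trans r" and tot: "(x, m) \<in> r \<or> (m, x) \<in> r" and re: "(x, x) \<in> r"
    using assms(1) insert m by (auto simp: order_on_defs refl_on_def total_on_def)
  show ?case
  proof (cases "(x, m) \<in> r")
    case True
    then show ?thesis using m re transD[OF tr] by (metis insert_iff)
  next
    case False
    then show ?thesis using m tot by auto
  qed
qed

text \<open>The minimum of a nonempty disjoint union lies in exactly one part; this turns external
  activity into the negation of \<open>inactive\<close>.\<close>

lemma min_in_swap:
  assumes "linear_order_on A r" "finite (P \<union> Q)" "P \<union> Q \<noteq> {}" "P \<union> Q \<subseteq> A" "P \<inter> Q = {}"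
  shows "min_in r P Q \<longleftrightarrow> \<not> min_in r Q P"
proof -
  have an: "antisym r" using assms(1) by (auto simp: order_on_defs)
  obtain m where m: "m \<in> P \<union> Q" "\<forall>g\<in>P \<union> Q. (m, g) \<in> r"
    using linear_order_on_finite_min[OF assms(1-4)] by blast
  have "m' = m" if "m' \<in> P \<union> Q" "\<forall>g\<in>P \<union> Q. (m', g) \<in> r" for m'
    using an m that by (meson antisymD)
  then show ?thesis using m assms(5) unfolding min_in_def by blast
qed

lemma linear_order_on_finite_max:
  assumes "linear_order_on A r" "finite S" "S \<noteq> {}" "S \<subseteq> A"
  shows "\<exists>m\<in>S. \<forall>g\<in>S. (g, m) \<in> r"
  using linear_order_on_finite_min[of A "r\<inverse>" S] assms by auto

section \<open>Branchings, ancestor sets and parking functions over a contracted root set\<close>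

context pre_digraph
begin

definition arc_rel :: "'b set \<Rightarrow> 'a rel" where
  "arc_rel S = (\<lambda>f. (tail G f, head G f)) ` S"

text \<open>For a branching \<open>S\<close> this is the arc set of the unique path from the root
  set to \<open>v\<close>. A set requires no choice of a path and behaves well under
  contraction.\<close>

definition ancestors :: "'b set \<Rightarrow> 'a \<Rightarrow> 'b set" where
  "ancestors S v = {f \<in> S. (head G f, v) \<in> (arc_rel S)\<^sup>*}"

text \<open>Here \<open>B\<close> is the part of the graph that has been contracted to the root and \<open>X\<close> is the set of
  arcs that have not been deleted or contracted.\<close>

definition branchings :: "'a set \<Rightarrow> 'b set \<Rightarrow> 'b set set" where
  "branchings B X = {S. S \<subseteq> X \<and> (\<forall>f\<in>S. head G f \<notin> B) \<and> inj_on (head G) S \<and>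
     (\<forall>v\<in>verts G. \<exists>b\<in>B. (b, v) \<in> (arc_rel S)\<^sup>*)}"

text \<open>The paths to the two ends of \<open>x\<close> share an initial segment, so the two sets below are the arc
  sets of the paths \<open>P2\<close> and \<open>P1\<close> of \<^const>\<open>path_pair\<close>.\<close>

definition inactive :: "'b rel \<Rightarrow> 'b set \<Rightarrow> 'b \<Rightarrow> bool" where
  "inactive r S x \<longleftrightarrow>
     min_in r (ancestors S (head G x) - insert x (ancestors S (tail G x)))
              (insert x (ancestors S (tail G x)) - ancestors S (head G x))"

definition inactives :: "'b rel \<Rightarrow> 'b set \<Rightarrow> 'b set \<Rightarrow> 'b set" where
  "inactives r X S = {x \<in> X - S. inactive r S x}"

text \<open>These are the G-parking functions (superstable configurations) with \<open>B\<close> as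
  sink. Arcs from \<open>B\<close> always count, as no admissible \<open>A\<close> meets
  \<open>B\<close>.\<close>

definition parking :: "'a set \<Rightarrow> 'b set \<Rightarrow> ('a \<Rightarrow> nat) set" where
  "parking B X = {p. (\<forall>v. v \<notin> verts G - B \<longrightarrow> p v = 0) \<and>
     (\<forall>A. A \<noteq> {} \<longrightarrow> A \<subseteq> verts G - B \<longrightarrow>
        (\<exists>v\<in>A. p v < card {x \<in> X. head G x = v \<and> tail G x \<notin> A}))}"

lemma parkingD:
  assumes "p \<in> parking B X"
  shows "v \<notin> verts G - B \<Longrightarrow> p v = 0"
    "A \<noteq> {} \<Longrightarrow> A \<subseteq> verts G - B \<Longrightarrow>
      \<exists>v\<in>A. p v < card {x \<in> X. head G x = v \<and> tail G x \<notin> A}"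
  using assms unfolding parking_def by auto

lemma arc_relI: "f \<in> S \<Longrightarrow> (tail G f, head G f) \<in> arc_rel S"
  unfolding arc_rel_def by blast

lemma arc_relE:
  assumes "(a, b) \<in> arc_rel S"
  obtains f where "f \<in> S" "a = tail G f" "b = head G f"
  using assms unfolding arc_rel_def by blast

lemma arc_rel_mono: "S \<subseteq> S' \<Longrightarrow> (arc_rel S)\<^sup>* \<subseteq> (arc_rel S')\<^sup>*"
  unfolding arc_rel_def by (intro rtrancl_mono) blast

lemma ancestors_subset: "ancestors S v \<subseteq> S"
  unfolding ancestors_def by blast

lemma branchingsD:
  assumes "S \<in> branchings B X"
  shows "S \<subseteq> X" "f \<in> S \<Longrightarrow> head G f \<notin> B"
    "f \<in> S \<Longrightarrow> g \<in> S \<Longrightarrow> head G f = head G g \<Longrightarrow> f = g"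
    "v \<in> verts G \<Longrightarrow> \<exists>b\<in>B. (b, v) \<in> (arc_rel S)\<^sup>*"
  using assms unfolding branchings_def by (auto simp: inj_on_def)

text \<open>No arc of \<open>S\<close> enters \<open>B\<close>, so a walk ending in \<open>B\<close>
  has no last arc.\<close>

lemma reach_root_eq:
  assumes "\<And>f. f \<in> S \<Longrightarrow> head G f \<notin> B" "(a, y) \<in> (arc_rel S)\<^sup>*" "y \<in> B"
  shows "a = y"
  using assms(2)
proof (cases rule: rtranclE)
  case (step z)
  then show ?thesis using assms by (auto elim: arc_relE)
qed

lemma ancestors_root:
  assumes "S \<in> branchings B X" "y \<in> B"
  shows "ancestors S y = {}"
  using reach_root_eq[of S B _ y] branchingsD(2)[OF assms(1)] assms(2)
  unfolding ancestors_def by fastforce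

text \<open>\<open>f\<close> is the only arc of \<open>S\<close> into its head, so it is the last
  arc of every nontrivial walk of \<open>S\<close> to that head.\<close>

lemma ancestors_head:
  assumes S: "S \<in> branchings B X" and f: "f \<in> S"
  shows "ancestors S (head G f) = insert f (ancestors S (tail G f))"
proof (intro equalityI subsetI)
  fix g assume g: "g \<in> ancestors S (head G f)"
  then have gS: "g \<in> S" and r: "(head G g, head G f) \<in> (arc_rel S)\<^sup>*" unfolding ancestors_def by auto
  from r show "g \<in> insert f (ancestors S (tail G f))"
  proof (cases rule: rtranclE)
    case base
    then show ?thesis using branchingsD(3)[OF S gS f] by simp
  next
    case (step z)
    from step(2) obtain h where "h \<in> S" "z = tail G h" "head G f = head G h" by (rule arc_relE)
    with branchingsD(3)[OF S f] have "z = tail G f" by blast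
    then show ?thesis using step gS unfolding ancestors_def by simp
  qed
next
  fix g assume "g \<in> insert f (ancestors S (tail G f))"
  then show "g \<in> ancestors S (head G f)"
    using f arc_relI[OF f] unfolding ancestors_def by (auto intro: rtrancl_into_rtrancl)
qed

text \<open>The path from \<open>B\<close> to \<open>y\<close> leaves \<open>B\<close> with its
  first arc and never returns. This first arc is what gets compared with the largest root
  arc.\<close>

lemma ancestors_first:
  assumes S: "S \<in> branchings B X" and y: "y \<in> verts G" "y \<notin> B"
  shows "\<exists>!f. f \<in> ancestors S y \<and> tail G f \<in> B"
proof -
  obtain b where b: "b \<in> B" "(b, y) \<in> (arc_rel S)\<^sup>*" using branchingsD(4)[OF S y(1)] by blast
  from b(2) have "y \<notin> B \<longrightarrow> (\<exists>!f. f \<in> ancestors S y \<and> tail G f \<in> B)"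
  proof (induction rule: rtrancl_induct)
    case base
    then show ?case using b by simp
  next
    case (step y z)
    obtain g where g: "g \<in> S" "y = tail G g" "z = head G g" using step(2) by (rule arc_relE)
    have anc: "ancestors S z = insert g (ancestors S y)" using ancestors_head[OF S g(1)] g by simp
    show ?case
    proof (cases "y \<in> B")
      case True
      then show ?thesis using anc ancestors_root[OF S True] g by auto
    next
      case False
      then show ?thesis using anc step.IH g by auto
    qed
  qed
  with y show ?thesis by blast
qed

lemma branchings_without:
  "{S \<in> branchings B X. e \<notin> S} = branchings B (X - {e})"
  unfolding branchings_def by blast

text \<open>A walk from \<open>B\<close> through \<open>e\<close> can be restarted at
  \<open>head G e\<close>, which now belongs to the root set.\<close>

lemma branchings_contract:
  assumes S: "S \<in> branchings B X" and e: "e \<in> S"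
  shows "S - {e} \<in> branchings (insert (head G e) B) (X - {e})"
proof -
  have "\<exists>b\<in>insert (head G e) B. (b, y) \<in> (arc_rel (S - {e}))\<^sup>*" if y: "y \<in> verts G" for y
  proof -
    obtain b where b: "b \<in> B" "(b, y) \<in> (arc_rel S)\<^sup>*" using branchingsD(4)[OF S y(1)] by blast
    from b(2) show ?thesis
    proof (induction rule: rtrancl_induct)
      case base
      then show ?case using b by blast
    next
      case (step y z)
      obtain g where g: "g \<in> S" "y = tail G g" "z = head G g" using step(2) by (rule arc_relE)
      show ?case
      proof (cases "g = e")
        case True
        then show ?thesis using g by blast
      next
        case False
        then have "(y, z) \<in> arc_rel (S - {e})" using g arc_relI[of g "S - {e}"] by simp
        then show ?thesis using step.IH by (meson rtrancl_into_rtrancl)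
      qed
    qed
  qed
  moreover have "\<forall>f\<in>S - {e}. head G f \<notin> insert (head G e) B"
    using branchingsD(2,3)[OF S] e by blast
  ultimately show ?thesis using S unfolding branchings_def by (auto simp: inj_on_def)
qed

lemma branchings_uncontract:
  assumes S: "S \<in> branchings (insert (head G e) B) (X - {e})"
    and e: "e \<in> X" "tail G e \<in> B" "head G e \<notin> B"
  shows "insert e S \<in> branchings B X"
proof -
  have "\<exists>b\<in>B. (b, y) \<in> (arc_rel (insert e S))\<^sup>*" if y: "y \<in> verts G" for y
  proof -
    obtain b where b: "b \<in> insert (head G e) B" "(b, y) \<in> (arc_rel S)\<^sup>*"
      using branchingsD(4)[OF S y(1)] by blast
    then have bby: "(b, y) \<in> (arc_rel (insert e S))\<^sup>*" using arc_rel_mono[of S "insert e S"] by blast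
    have "(tail G e, head G e) \<in> arc_rel (insert e S)" by (simp add: arc_relI)
    then show ?thesis using bby b(1) e by (metis converse_rtrancl_into_rtrancl insert_iff)
  qed
  then show ?thesis using S e unfolding branchings_def by (auto simp: inj_on_def)
qed

text \<open>The walks behind \<open>ancestors\<close> start at heads of arcs of \<open>S\<close>,
  hence outside \<open>B\<close>, and never enter \<open>B\<close>. As \<open>e\<close> starts in
  \<open>B\<close>, none of them uses \<open>e\<close>.\<close>

lemma ancestors_contract:
  assumes S: "S \<in> branchings B X" and e: "e \<in> S" "tail G e \<in> B"
  shows "ancestors (S - {e}) y = ancestors S y - {e}"
proof -
  have "(a, y) \<in> (arc_rel (S - {e}))\<^sup>*" if "(a, y) \<in> (arc_rel S)\<^sup>*" "a \<notin> B" for a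
    using that
  proof (induction rule: rtrancl_induct)
    case (step y z)
    obtain g where g: "g \<in> S" "y = tail G g" "z = head G g" using step(2) by (rule arc_relE)
    have "y \<notin> B" using reach_root_eq[of S B a y] branchingsD(2)[OF S] step by blast
    with g e have "g \<in> S - {e}" by auto
    from arc_relI[OF this] g step show ?case by (auto intro: rtrancl_into_rtrancl)
  qed simp
  then show ?thesis using branchingsD(2)[OF S] arc_rel_mono[of "S - {e}" S]
    unfolding ancestors_def by blast
qed

end

section \<open>The deletion-contraction recursion for activities and for parking functions\<close>

context fin_digraph
begin

text \<open>With \<open>tail G e\<close> in the root, the path through \<open>e\<close> is
  \<open>e\<close> alone, whereas the path in \<open>S\<close> to \<open>head G e\<close> starts
  with a root arc below \<open>e\<close> and so holds the minimum. The other arcs keep their status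
  because \<open>S\<close> is unchanged.\<close>

lemma inactives_delete:
  assumes r: "linear_order_on (arcs G) r" and X: "X \<subseteq> arcs G"
    and e: "e \<in> X" "tail G e \<in> B" "head G e \<notin> B"
    and mx: "\<And>f. f \<in> X \<Longrightarrow> tail G f \<in> B \<Longrightarrow> head G f \<notin> B \<Longrightarrow> (f, e) \<in> r"
    and S: "S \<in> branchings B X" and eS: "e \<notin> S"
  shows "inactives r X S = insert e (inactives r (X - {e}) S)"
proof -
  have tr: "trans r" using r by (auto simp: order_on_defs)
  let ?A = "ancestors S (head G e)"
  have SX: "S \<subseteq> X" using branchingsD(1)[OF S] .
  obtain f where f: "f \<in> ?A" "tail G f \<in> B"
    using ancestors_first[OF S _ e(3)] e X head_in_verts by blast
  have fS: "f \<in> S" using f ancestors_subset by blast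
  have fe: "(f, e) \<in> r" "f \<noteq> e" using mx[of f] fS SX f(2) branchingsD(2)[OF S] eS by auto
  have A1: "ancestors S (tail G e) = {}" using ancestors_root[OF S e(2)] .
  have eA: "e \<notin> ?A" using eS ancestors_subset by blast
  have "finite ?A" "?A \<subseteq> arcs G"
    using ancestors_subset SX X finite_subset[OF _ finite_arcs] by blast+
  then obtain m where "m \<in> ?A" "\<forall>g\<in>?A. (m, g) \<in> r"
    using linear_order_on_finite_min[OF r, of ?A] f by blast
  then have "inactive r S e"
    unfolding inactive_def A1 min_in_def using eA f fe transD[OF tr] by (intro bexI[of _ m]) auto
  then show ?thesis using e eS unfolding inactives_def by auto
qed

lemma inactives_contract:
  assumes r: "linear_order_on (arcs G) r" and X: "X \<subseteq> arcs G"
    and e: "e \<in> X" "tail G e \<in> B" "head G e \<notin> B"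
    and mx: "\<And>f. f \<in> X \<Longrightarrow> tail G f \<in> B \<Longrightarrow> head G f \<notin> B \<Longrightarrow> (f, e) \<in> r"
    and S: "S \<in> branchings B X" and eS: "e \<in> S"
  shows "inactives r X S = inactives r (X - {e}) (S - {e})"
proof -
  have tr: "trans r" and an: "antisym r" using r by (auto simp: order_on_defs)
  have SX: "S \<subseteq> X" using branchingsD(1)[OF S] .
  have "inactive r S x \<longleftrightarrow> inactive r (S - {e}) x" if x: "x \<in> X" "x \<notin> S" for x
  proof -
    define A1 where "A1 = insert x (ancestors S (tail G x))"
    define A2 where "A2 = ancestors S (head G x)"
    have xe: "x \<noteq> e" using x eS by blast
    have A1': "insert x (ancestors (S - {e}) (tail G x)) = A1 - {e}"
      and A2': "ancestors (S - {e}) (head G x) = A2 - {e}"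
      unfolding A1_def A2_def ancestors_contract[OF S eS e(2)] using xe by auto
    have inact: "inactive r S x \<longleftrightarrow> min_in r (A2 - A1) (A1 - A2)"
      unfolding inactive_def A1_def A2_def ..
    have inact': "inactive r (S - {e}) x \<longleftrightarrow> min_in r ((A2 - A1) - {e}) ((A1 - A2) - {e})"
    proof -
      have "(A2 - {e}) - (A1 - {e}) = (A2 - A1) - {e}" "(A1 - {e}) - (A2 - {e}) = (A1 - A2) - {e}"
        by auto
      then show ?thesis unfolding inactive_def A1' A2' by simp
    qed
    have xV: "head G x \<in> verts G" "tail G x \<in> verts G" using x X by auto
    have fr: "(f, e) \<in> r" if "f \<in> S" "tail G f \<in> B" for f
      using mx[of f] that SX branchingsD(2)[OF S] by blast
    have xA2: "x \<notin> A2" using x ancestors_subset unfolding A2_def by blast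
    have uniq1: "f = e" if "e \<in> A1" "f \<in> A1" "f \<noteq> x" "tail G f \<in> B" for f
    proof -
      have *: "e \<in> ancestors S (tail G x)" "f \<in> ancestors S (tail G x)"
        using that xe unfolding A1_def by auto
      then have "tail G x \<notin> B" using ancestors_root[OF S] by blast
      then show ?thesis using ancestors_first[OF S xV(2)] * e that by blast
    qed
    have uniq2: "f = e" if "e \<in> A2" "f \<in> A2" "tail G f \<in> B" for f
    proof -
      have "head G x \<notin> B" using ancestors_root[OF S] that unfolding A2_def by blast
      then show ?thesis using ancestors_first[OF S xV(1)] e that unfolding A2_def by blast
    qed
    \<comment> \<open>Either \<open>e\<close> is absent from both differences; or
      \<open>head G x\<close> lies in the root and \<open>x\<close> is inactive on neither side; or
      the path without \<open>e\<close> starts with a smaller root arc, so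
      \<open>min_in_remove\<close> applies.\<close>
    consider "e \<notin> (A2 - A1) \<union> (A1 - A2)" | "e \<in> A1" "e \<notin> A2" "A2 = {}"
      | "e \<in> A1" "e \<notin> A2" "A2 \<noteq> {}" | "e \<in> A2" "e \<notin> A1" by blast
    then show ?thesis
    proof cases
      case 1
      then show ?thesis unfolding inact inact' by (simp add: Diff_triv)
    next
      case 2
      then show ?thesis unfolding inact inact' by (simp add: min_in_def)
    next
      case 3
      then have "head G x \<notin> B" using ancestors_root[OF S] unfolding A2_def by blast
      then obtain f where f: "f \<in> A2" "tail G f \<in> B"
        using ancestors_first[OF S xV(1)] unfolding A2_def by blast
      have fS: "f \<in> S" using f ancestors_subset unfolding A2_def by blast
      have "f \<noteq> e" using f 3 by blast
      then have "f \<notin> A1" using uniq1 3 f xA2 by blast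
      then show ?thesis unfolding inact inact'
        using min_in_remove[OF an tr _ \<open>f \<noteq> e\<close> fr[OF fS f(2)]] f by blast
    next
      case 4
      then have hx: "head G x \<notin> B" using ancestors_root[OF S] unfolding A2_def by blast
      obtain f where f: "f \<in> A1" "tail G f \<in> B"
        using ancestors_first[OF S xV(2)] unfolding A1_def by blast
      have fe: "f \<noteq> e" using f 4 by blast
      have "(f, e) \<in> r"
      \<comment> \<open>If \<open>tail G x\<close> lies in \<open>B\<close>, the first arc is
        \<open>x\<close> itself; it is not in \<open>S\<close>, but it is a root arc because its
        head is outside \<open>B\<close>.\<close>
      proof (cases "f = x")
        case True
        then show ?thesis using mx x f hx by blast
      next
        case False
        then have "f \<in> S" using f ancestors_subset unfolding A1_def by blast
        then show ?thesis using fr f by blast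
      qed
      moreover have "f \<notin> A2" using uniq2 4 f fe by blast
      ultimately show ?thesis unfolding inact inact'
        using min_in_remove[OF an tr _ fe] f by blast
    qed
  qed
  then show ?thesis unfolding inactives_def using eS by blast
qed

lemma finite_branchings: "X \<subseteq> arcs G \<Longrightarrow> finite (branchings B X)"
  by (rule finite_subset[of _ "Pow (arcs G)"]) (auto simp: branchings_def)

lemma parking_less:
  assumes "p \<in> parking B X" "v \<in> verts G - B"
  shows "p v < card {x \<in> X. head G x = v \<and> tail G x \<noteq> v}"
  using assms unfolding parking_def by (auto dest: spec[of _ "{v}"])

lemma finite_parking:
  assumes "X \<subseteq> arcs G"
  shows "finite (parking B X)"
proof (rule finite_subset)
  show "parking B X \<subseteq> {p. \<forall>v. (v \<in> verts G \<longrightarrow> p v \<in> {..card (arcs G)}) \<and> (v \<notin> verts G \<longrightarrow> p v = 0)}"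
  proof (intro subsetI CollectI allI conjI impI)
    fix p v assume p: "p \<in> parking B X"
    show "p v = 0" if "v \<notin> verts G" using p that unfolding parking_def by blast
    show "p v \<in> {..card (arcs G)}" if "v \<in> verts G"
    proof (cases "v \<in> B")
      case True
      then show ?thesis using p unfolding parking_def by auto
    next
      case False
      then have "p v < card {x \<in> X. head G x = v \<and> tail G x \<noteq> v}" using parking_less[OF p] that by blast
      also have "\<dots> \<le> card (arcs G)" using assms by (intro card_mono) auto
      finally show ?thesis by simp
    qed
  qed
  show "finite {p. \<forall>v. (v \<in> verts G \<longrightarrow> p v \<in> {..card (arcs G)}) \<and> (v \<notin> verts G \<longrightarrow> p v = 0)}"
    by (intro finite_set_of_finite_funs) auto
qed

text \<open>If \<open>A\<close> contains \<open>head G e\<close>, then \<open>e\<close> enters it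
  from outside and the value 0 passes the test; for any other \<open>A\<close> the arc
  \<open>e\<close> is not counted.\<close>

lemma parking_contract:
  assumes X: "X \<subseteq> arcs G" and e: "e \<in> X" "tail G e \<in> B" "head G e \<notin> B"
  shows "{p \<in> parking B X. p (head G e) = 0} = parking (insert (head G e) B) (X - {e})"
proof (intro equalityI subsetI)
  fix p assume p: "p \<in> {p \<in> parking B X. p (head G e) = 0}"
  have "\<exists>v\<in>A. p v < card {x \<in> X - {e}. head G x = v \<and> tail G x \<notin> A}"
    if A: "A \<noteq> {}" "A \<subseteq> verts G - insert (head G e) B" for A
  proof -
    obtain v where v: "v \<in> A" "p v < card {x \<in> X. head G x = v \<and> tail G x \<notin> A}"
      using parkingD(2)[of p B X A] p A by auto
    have eq: "{x \<in> X. head G x = v \<and> tail G x \<notin> A} = {x \<in> X - {e}. head G x = v \<and> tail G x \<notin> A}"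
      using v A by auto
    show ?thesis using v(2) unfolding eq by (intro bexI[OF _ v(1)])
  qed
  with p show "p \<in> parking (insert (head G e) B) (X - {e})" unfolding parking_def by auto
next
  fix p assume p: "p \<in> parking (insert (head G e) B) (X - {e})"
  have p0: "p (head G e) = 0" using p unfolding parking_def by auto
  have "\<exists>v\<in>A. p v < card {x \<in> X. head G x = v \<and> tail G x \<notin> A}"
    if A: "A \<noteq> {}" "A \<subseteq> verts G - B" for A
  proof (cases "head G e \<in> A")
    case True
    have "e \<in> {x \<in> X. head G x = head G e \<and> tail G x \<notin> A}" using e A by blast
    moreover have "finite {x \<in> X. head G x = head G e \<and> tail G x \<notin> A}"
      using finite_subset[OF X] by simp
    ultimately have "0 < card {x \<in> X. head G x = head G e \<and> tail G x \<notin> A}"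
      using card_gt_0_iff by blast
    then show ?thesis unfolding p0[symmetric] by (intro bexI[OF _ True])
  next
    case False
    then have A': "A \<subseteq> verts G - insert (head G e) B" using A by blast
    then obtain v where v: "v \<in> A" "p v < card {x \<in> X - {e}. head G x = v \<and> tail G x \<notin> A}"
      using parkingD(2)[OF p A(1) A'] by blast
    have eq: "{x \<in> X. head G x = v \<and> tail G x \<notin> A} = {x \<in> X - {e}. head G x = v \<and> tail G x \<notin> A}"
      using v False by auto
    show ?thesis using v(2) unfolding eq[symmetric] by (intro bexI[OF _ v(1)])
  qed
  with p p0 show "p \<in> {p \<in> parking B X. p (head G e) = 0}" unfolding parking_def by auto
qed

text \<open>As \<open>tail G e\<close> lies in \<open>B\<close>, deleting \<open>e\<close> lowers
  the bound at \<open>head G e\<close> by exactly one for every \<open>A\<close> containing that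
  vertex.\<close>

lemma parking_delete_iff:
  assumes X: "X \<subseteq> arcs G" and e: "e \<in> X" "tail G e \<in> B" "head G e \<notin> B"
  shows "p(head G e := Suc (p (head G e))) \<in> parking B X \<longleftrightarrow> p \<in> parking B (X - {e})"
proof -
  let ?q = "p(head G e := Suc (p (head G e)))"
  have eV: "head G e \<in> verts G - B" using e X by auto
  have "?q v < card {x \<in> X. head G x = v \<and> tail G x \<notin> A} \<longleftrightarrow>
        p v < card {x \<in> X - {e}. head G x = v \<and> tail G x \<notin> A}"
    if A: "A \<subseteq> verts G - B" and v: "v \<in> A" for A v
  proof (cases "v = head G e")
    case True
    have "{x \<in> X. head G x = v \<and> tail G x \<notin> A} = insert e {x \<in> X - {e}. head G x = v \<and> tail G x \<notin> A}"
      using True e A by auto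
    moreover have "finite {x \<in> X - {e}. head G x = v \<and> tail G x \<notin> A}"
      using finite_subset[OF X] by simp
    ultimately have "card {x \<in> X. head G x = v \<and> tail G x \<notin> A}
        = Suc (card {x \<in> X - {e}. head G x = v \<and> tail G x \<notin> A})" by simp
    then show ?thesis using True by simp
  next
    case False
    then have "{x \<in> X. head G x = v \<and> tail G x \<notin> A} = {x \<in> X - {e}. head G x = v \<and> tail G x \<notin> A}"
      by auto
    then show ?thesis using False by simp
  qed
  moreover have "(\<forall>v. v \<notin> verts G - B \<longrightarrow> ?q v = 0) \<longleftrightarrow> (\<forall>v. v \<notin> verts G - B \<longrightarrow> p v = 0)"
    using eV by (metis fun_upd_other)
  moreover have "(\<exists>v\<in>A. ?q v < card {x \<in> X. head G x = v \<and> tail G x \<notin> A}) \<longleftrightarrow>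
        (\<exists>v\<in>A. p v < card {x \<in> X - {e}. head G x = v \<and> tail G x \<notin> A})"
    if A: "A \<subseteq> verts G - B" for A
    using calculation(1)[OF A] by (intro bex_cong refl) auto
  ultimately show ?thesis unfolding parking_def mem_Collect_eq by (intro conj_cong) auto
qed

text \<open>\<open>g\<close> is arbitrary because the deletion branch shifts the statistic by one:
  there the induction hypothesis is applied to \<open>g\<close> composed with
  \<open>Suc\<close>.\<close>

lemma branchings_parking_sum:
  fixes g :: "nat \<Rightarrow> 'c :: comm_monoid_add"
  assumes r: "linear_order_on (arcs G) r" and "X \<subseteq> arcs G" "B \<subseteq> verts G"
  shows "(\<Sum>S\<in>branchings B X. g (card (inactives r X S))) = (\<Sum>p\<in>parking B X. g (sum p (verts G)))"
  using assms(2-)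
proof (induction "card X" arbitrary: X B g rule: less_induct)
  case (less X B g)
  have X: "X \<subseteq> arcs G" and B: "B \<subseteq> verts G" using less.prems by auto
  have finX: "finite X" using finite_subset[OF X] by simp
  \<comment> \<open>The root arcs; without any, no branching can extend beyond
    \<open>B\<close>.\<close>
  define Fr where "Fr = {f \<in> X. tail G f \<in> B \<and> head G f \<notin> B}"
  show ?case
  proof (cases "Fr = {}")
    case True
    show ?thesis
    proof (cases "B = verts G")
      case BV: True
      have "S = {}" if "S \<in> branchings B X" for S
        using branchingsD(1,2)[OF that] X BV by fastforce
      moreover have "{} \<in> branchings B X" using BV unfolding branchings_def by auto
      ultimately have 1: "branchings B X = {{}}" by blast
      have 2: "parking B X = {\<lambda>_. 0}" using BV unfolding parking_def by auto
      \<comment> \<open>All ancestor sets are empty, so the set that would have to hold the minimum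
        is empty.\<close>
      have "inactives r X {} = {}"
        unfolding inactives_def inactive_def ancestors_def min_in_def by simp
      then show ?thesis unfolding 1 2 by simp
    next
      case False
      then obtain v where v: "v \<in> verts G" "v \<notin> B" using B by blast
      have "S \<notin> branchings B X" for S
      proof
        assume S: "S \<in> branchings B X"
        obtain f where "f \<in> ancestors S v" "tail G f \<in> B" using ancestors_first[OF S v] by blast
        moreover from this have "f \<in> S" using ancestors_subset by blast
        ultimately show False using True branchingsD(1,2)[OF S] unfolding Fr_def by blast
      qed
      moreover have "p \<notin> parking B X" for p
      proof
        assume "p \<in> parking B X"
        \<comment> \<open>The test set consists of all vertices outside \<open>B\<close>: only root
          arcs enter it from outside, so all its bounds are 0.\<close>
        then obtain w where w: "w \<in> verts G - B"
          "p w < card {x \<in> X. head G x = w \<and> tail G x \<notin> verts G - B}"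
          using parkingD(2)[of p B X "verts G - B"] v by auto
        have "{x \<in> X. head G x = w \<and> tail G x \<notin> verts G - B} = {}"
          using True w(1) X unfolding Fr_def by auto
        then have "card {x \<in> X. head G x = w \<and> tail G x \<notin> verts G - B} = 0"
          by (simp only: card.empty)
        with w(2) show False by (simp only: not_less0)
      qed
      ultimately have "branchings B X = {}" "parking B X = {}" by auto
      then show ?thesis by simp
    qed
  next
    case False
    have "finite Fr" "Fr \<subseteq> arcs G" using finX X unfolding Fr_def by auto
    then obtain e where e: "e \<in> Fr" "\<forall>f\<in>Fr. (f, e) \<in> r"
      using linear_order_on_finite_max[OF r _ False] by blast
    have eX: "e \<in> X" "tail G e \<in> B" "head G e \<notin> B" using e unfolding Fr_def by auto
    have mx: "(f, e) \<in> r" if "f \<in> X" "tail G f \<in> B" "head G f \<notin> B" for f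
      using e that unfolding Fr_def by blast
    let ?v = "head G e"
    have vV: "?v \<in> verts G" using eX X by auto
    have cX: "card (X - {e}) < card X" using finX eX by (meson card_Diff1_less)
    have X': "X - {e} \<subseteq> arcs G" using X by blast
    have B': "insert ?v B \<subseteq> verts G" using B vV by blast
    note fb = finite_branchings[OF X, of B] and fp = finite_parking[OF X, of B]

    have "(\<Sum>S\<in>branchings B X. g (card (inactives r X S))) =
        (\<Sum>S\<in>{S \<in> branchings B X. e \<notin> S}. g (card (inactives r X S))) +
        (\<Sum>S\<in>{S \<in> branchings B X. e \<in> S}. g (card (inactives r X S)))"
      using fb by (subst sum.union_disjoint[symmetric]) (auto intro: sum.cong)
    also have "(\<Sum>S\<in>{S \<in> branchings B X. e \<notin> S}. g (card (inactives r X S))) =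
        (\<Sum>S\<in>branchings B (X - {e}). g (Suc (card (inactives r (X - {e}) S))))"
    proof (rule sum.cong[OF branchings_without])
      fix S assume "S \<in> branchings B (X - {e})"
      then have S: "S \<in> branchings B X" "e \<notin> S" using branchings_without by blast+
      have "finite (inactives r (X - {e}) S)" "e \<notin> inactives r (X - {e}) S"
        using finX unfolding inactives_def by auto
      then show "g (card (inactives r X S)) = g (Suc (card (inactives r (X - {e}) S)))"
        using inactives_delete[OF r X eX mx S] by simp
    qed
    also have "\<dots> = (\<Sum>p\<in>parking B (X - {e}). g (Suc (sum p (verts G))))"
      using less.hyps[OF cX X' B, of "\<lambda>n. g (Suc n)"] .
    also have "\<dots> = (\<Sum>p\<in>{p \<in> parking B X. p ?v \<noteq> 0}. g (sum p (verts G)))"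
    proof (rule sum.reindex_bij_witness[of _ "\<lambda>p. p(?v := p ?v - 1)" "\<lambda>p. p(?v := Suc (p ?v))"])
      fix p assume p: "p \<in> parking B (X - {e})"
      show "(p(?v := Suc (p ?v)))(?v := (p(?v := Suc (p ?v))) ?v - 1) = p" by simp
      show "p(?v := Suc (p ?v)) \<in> {p \<in> parking B X. p ?v \<noteq> 0}"
        using parking_delete_iff[OF X eX] p by simp
      have "sum (p(?v := Suc (p ?v))) (verts G) = Suc (p ?v) + sum p (verts G - {?v})"
        using sum.remove[OF finite_verts vV, of "p(?v := Suc (p ?v))"] sum.cong[of "verts G - {?v}"]
        by (metis (no_types, lifting) Diff_iff fun_upd_apply insertI1)
      also have "\<dots> = Suc (sum p (verts G))" using sum.remove[OF finite_verts vV, of p] by simp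
      finally show "g (sum (p(?v := Suc (p ?v))) (verts G)) = g (Suc (sum p (verts G)))" by simp
    next
      fix p assume p: "p \<in> {p \<in> parking B X. p ?v \<noteq> 0}"
      show *: "(p(?v := p ?v - 1))(?v := Suc ((p(?v := p ?v - 1)) ?v)) = p" using p by auto
      show "p(?v := p ?v - 1) \<in> parking B (X - {e})"
        using parking_delete_iff[OF X eX, of "p(?v := p ?v - 1)"] p unfolding * by blast
    qed
    also have "(\<Sum>S\<in>{S \<in> branchings B X. e \<in> S}. g (card (inactives r X S))) =
        (\<Sum>S\<in>branchings (insert ?v B) (X - {e}). g (card (inactives r (X - {e}) S)))"
    proof (rule sum.reindex_bij_witness[of _ "insert e" "\<lambda>S. S - {e}"])
      fix S assume "S \<in> {S \<in> branchings B X. e \<in> S}"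
      then have S: "S \<in> branchings B X" "e \<in> S" by auto
      then show "insert e (S - {e}) = S" by blast
      show "S - {e} \<in> branchings (insert ?v B) (X - {e})" using branchings_contract[OF S] .
      show "g (card (inactives r (X - {e}) (S - {e}))) = g (card (inactives r X S))"
        using inactives_contract[OF r X eX mx S] by simp
    next
      fix S assume S: "S \<in> branchings (insert ?v B) (X - {e})"
      show "insert e S - {e} = S" using branchingsD(1)[OF S] by blast
      show "insert e S \<in> {S \<in> branchings B X. e \<in> S}"
        using branchings_uncontract[OF S eX] by blast
    qed
    also have "\<dots> = (\<Sum>p\<in>parking (insert ?v B) (X - {e}). g (sum p (verts G)))"
      using less.hyps[OF cX X' B'] .
    also have "parking (insert ?v B) (X - {e}) = {p \<in> parking B X. p ?v = 0}"
      using parking_contract[OF X eX] by simp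
    also have "(\<Sum>p\<in>{p \<in> parking B X. p ?v \<noteq> 0}. g (sum p (verts G))) +
        (\<Sum>p\<in>{p \<in> parking B X. p ?v = 0}. g (sum p (verts G))) =
        (\<Sum>p\<in>parking B X. g (sum p (verts G)))"
      using fp by (subst sum.union_disjoint[symmetric]) (auto intro: sum.cong)
    finally show ?thesis .
  qed
qed

end


section \<open>Arborescences and external activity\<close>

lemma common_prefix_split:
  "\<exists>q a b. xs = q @ a \<and> ys = q @ b \<and> (a = [] \<or> b = [] \<or> hd a \<noteq> hd b)"
proof (induction xs arbitrary: ys)
  case (Cons x xs)
  show ?case
  proof (cases "ys \<noteq> [] \<and> hd ys = x")
    case True
    then obtain ys' where ys: "ys = x # ys'" by (cases ys) auto
    obtain q a b where "xs = q @ a" "ys' = q @ b" "a = [] \<or> b = [] \<or> hd a \<noteq> hd b"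
      using Cons.IH[of ys'] by blast
    then show ?thesis using ys by (intro exI[of _ "x # q"] exI[of _ a] exI[of _ b]) auto
  next
    case False
    then show ?thesis by (intro exI[of _ "[]"] exI[of _ "x # xs"] exI[of _ ys]) auto
  qed
qed simp

context wf_digraph
begin

lemma awalk_snoc_iff:
  "awalk u (p @ [f]) v \<longleftrightarrow> awalk u p (tail G f) \<and> f \<in> arcs G \<and> head G f = v"
  by (auto simp: awalk_simps)

lemma cas_last:
  assumes "cas u p w" "p \<noteq> []"
  shows "head G (last p) = w"
  using awlast_if_cas[OF assms(1)] assms(2) by (simp add: awalk_verts_conv)

lemma reach_iff_awalk:
  assumes "u \<in> verts G"
  shows "(u, v) \<in> (arc_rel (arcs G))\<^sup>* \<longleftrightarrow> (\<exists>p. awalk u p v)"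
proof
  assume "(u, v) \<in> (arc_rel (arcs G))\<^sup>*"
  then show "\<exists>p. awalk u p v"
  proof (induction rule: rtrancl_induct)
    case base
    then show ?case using assms by (auto simp: awalk_Nil_iff intro: exI[of _ "[]"])
  next
    case (step y z)
    then obtain p f where "awalk u p y" "f \<in> arcs G" "y = tail G f" "z = head G f"
      by (auto elim: arc_relE)
    then have "awalk u (p @ [f]) z" by (auto simp only: awalk_snoc_iff)
    then show ?case ..
  qed
next
  assume "\<exists>p. awalk u p v"
  then obtain p where "awalk u p v" ..
  then show "(u, v) \<in> (arc_rel (arcs G))\<^sup>*"
  proof (induction p arbitrary: v rule: rev_induct)
    case Nil
    then show ?case by (simp add: awalk_Nil_iff)
  next
    case (snoc f p)
    then show ?case using arc_relI[of f "arcs G"]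
      by (auto simp: awalk_snoc_iff simp del: awalk_append_iff intro: rtrancl_into_rtrancl)
  qed
qed

text \<open>Uniqueness of walks forbids arcs into \<open>s\<close> and two arcs with the same head.
  Conversely, two walks to the same vertex are compared backwards from their last arcs.\<close>

lemma unique_awalk_iff_branching:
  assumes s: "s \<in> verts G"
  shows "(\<forall>v\<in>verts G. \<exists>!p. awalk s p v) \<longleftrightarrow> arcs G \<in> branchings {s} (arcs G)"
proof
  assume U: "\<forall>v\<in>verts G. \<exists>!p. awalk s p v"
  have "head G f \<noteq> s" if f: "f \<in> arcs G" for f
  proof
    assume h: "head G f = s"
    obtain p where "awalk s p (tail G f)" using U f by (meson tail_in_verts)
    then have "awalk s (p @ [f]) s" using f h by (simp add: awalk_snoc_iff del: awalk_append_iff)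
    moreover have "awalk s [] s" using s by (simp add: awalk_Nil_iff)
    ultimately show False using U s by blast
  qed
  moreover have "f = g" if fg: "f \<in> arcs G" "g \<in> arcs G" "head G f = head G g" for f g
  proof -
    obtain p q where "awalk s p (tail G f)" "awalk s q (tail G g)" using U fg by (meson tail_in_verts)
    then have "awalk s (p @ [f]) (head G f)" "awalk s (q @ [g]) (head G f)"
      using fg by (simp_all add: awalk_snoc_iff del: awalk_append_iff)
    then have "p @ [f] = q @ [g]" using U fg head_in_verts by blast
    then show ?thesis by simp
  qed
  moreover have "(s, v) \<in> (arc_rel (arcs G))\<^sup>*" if "v \<in> verts G" for v
    using U that reach_iff_awalk[OF s] by blast
  ultimately show "arcs G \<in> branchings {s} (arcs G)"
    unfolding branchings_def by (auto simp: inj_on_def)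
next
  assume S: "arcs G \<in> branchings {s} (arcs G)"
  have "p = q" if "awalk s p v" "awalk s q v" for p q v
    using that
  proof (induction p arbitrary: q v rule: rev_induct)
    case Nil
    then show ?case using branchingsD(2)[OF S]
      by (cases q rule: rev_cases)
         (auto simp: awalk_snoc_iff awalk_Nil_iff simp del: awalk_append_iff)
  next
    case (snoc f p)
    have f: "awalk s p (tail G f)" "f \<in> arcs G" "head G f = v"
      using snoc.prems(1) by (simp_all only: awalk_snoc_iff)
    show ?case
    proof (cases q rule: rev_cases)
      case Nil
      then show ?thesis using snoc.prems(2) f branchingsD(2)[OF S f(2)] by (simp add: awalk_Nil_iff)
    next
      case (snoc q' g)
      have g: "awalk s q' (tail G g)" "g \<in> arcs G" "head G g = v"
        using snoc.prems(2) snoc by (simp_all only: awalk_snoc_iff)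
      have "f = g" using branchingsD(3)[OF S] f g by blast
      then show ?thesis using snoc.IH[of "tail G f" q'] f g snoc by simp
    qed
  qed
  moreover have "\<exists>p. awalk s p v" if "v \<in> verts G" for v
    using branchingsD(4)[OF S that] reach_iff_awalk[OF s] by blast
  ultimately show "\<forall>v\<in>verts G. \<exists>!p. awalk s p v" by blast
qed

text \<open>In a forest every walk is a path; conversely, a cycle could be appended to a walk to
  produce a second one. Walks are preferred later because they concatenate freely.\<close>

lemma forest_unique_apath_iff:
  assumes s: "s \<in> verts G"
  shows "forest G \<and> (\<forall>v\<in>verts G. \<exists>!p. apath s p v) \<longleftrightarrow> (\<forall>v\<in>verts G. \<exists>!p. awalk s p v)"
proof
  assume F: "forest G \<and> (\<forall>v\<in>verts G. \<exists>!p. apath s p v)"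
  have "apath s p v" if p: "awalk s p v" for p v
  proof (rule ccontr)
    assume "\<not> apath s p v"
    then have "\<not> distinct (awalk_verts s p)" using p unfolding apath_def by blast
    then obtain w c where "awalk w c w" "0 < length c"
      using awalk_not_distinct_decomp[OF p] by blast
    then have "closed_w c" unfolding closed_w_def by blast
    then show False using closed_w_imp_cycle F unfolding forest_def by blast
  qed
  then show "\<forall>v\<in>verts G. \<exists>!p. awalk s p v" using F by (metis awalkI_apath)
next
  assume U: "\<forall>v\<in>verts G. \<exists>!p. awalk s p v"
  have "forest G" unfolding forest_def
  proof
    assume "\<exists>p. cycle p"
    then obtain u c where c: "awalk u c u" "c \<noteq> []" unfolding cycle_def by blast
    then have u: "u \<in> verts G" by (simp add: awalk_hd_in_verts)
    then obtain q where q: "awalk s q u" using U by blast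
    then have "awalk s (q @ c) u" using c awalk_appendI by blast
    then have "q @ c = q" using q U u by blast
    then show False using c by simp
  qed
  moreover have "\<exists>!p. apath s p v" if v: "v \<in> verts G" for v
  proof -
    obtain p where "awalk s p v" using U v by blast
    then have "apath s (awalk_to_apath p) v" by (rule apath_awalk_to_apath)
    then show ?thesis using U v awalkI_apath by blast
  qed
  ultimately show "forest G \<and> (\<forall>v\<in>verts G. \<exists>!p. apath s p v)" by blast
qed

text \<open>Adding an arc changes neither tails nor heads, so the conditions on walks in the
  extended graph can be stated with the notions of \<open>G\<close>.\<close>

lemma path_pair_conv:
  assumes e: "tail G e \<in> verts G" "head G e \<in> verts G"
  shows "path_pair G e u P1 P2 \<longleftrightarrow> u \<in> verts G \<and>
    set P1 \<subseteq> insert e (arcs G) \<and> cas u P1 (head G e) \<and>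
    (distinct (awalk_verts u P1) \<or> u = head G e \<and> distinct (tl (awalk_verts u P1))) \<and>
    set P2 \<subseteq> insert e (arcs G) \<and> cas u P2 (head G e) \<and> distinct (awalk_verts u P2) \<and>
    e \<in> set P1 \<and> set P1 \<inter> set P2 = {}"
proof -
  let ?H = "add_arc e"
  have "compatible ?H G" by (simp add: compatible_def)
  then have cas: "pre_digraph.cas ?H = cas" and verts: "pre_digraph.awalk_verts ?H = awalk_verts"
    using compatible_cas compatible_awalk_verts by blast+
  have walk: "pre_digraph.awalk ?H u p v \<longleftrightarrow> u \<in> verts G \<and> set p \<subseteq> insert e (arcs G) \<and> cas u p v" for u p v
    unfolding pre_digraph.awalk_def cas using e by simp
  have path: "pre_digraph.apath ?H u p v \<longleftrightarrow>
      u \<in> verts G \<and> set p \<subseteq> insert e (arcs G) \<and> cas u p v \<and> distinct (awalk_verts u p)" for u p v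
    unfolding pre_digraph.apath_def walk verts by blast
  have cyc: "(u = w \<and> pre_digraph.awalk ?H u p w \<and> pre_digraph.cycle ?H p) \<longleftrightarrow>
     u = w \<and> pre_digraph.awalk ?H u p w \<and> distinct (tl (awalk_verts u p))"
    if "p \<noteq> []" for u p w
    unfolding pre_digraph.cycle_def verts using that awalk_verts_ne_eq[OF that] by metis
  show ?thesis
  proof (cases "P1 = []")
    case False
    show ?thesis unfolding path_pair_def Let_def cyc[OF False] unfolding path walk by blast
  qed (simp add: path_pair_def)
qed

context
  fixes s
  assumes s: "s \<in> verts G" and U: "\<forall>v\<in>verts G. \<exists>!p. awalk s p v"
begin

lemma unique_awalkD: "awalk s p v \<Longrightarrow> awalk s q v \<Longrightarrow> p = q"
  using U awalk_last_in_verts[of s p v] by blast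

lemma ancestors_eq_set_awalk:
  assumes p: "awalk s p v"
  shows "ancestors (arcs G) v = set p"
proof (intro equalityI subsetI)
  fix f assume f: "f \<in> ancestors (arcs G) v"
  then have fa: "f \<in> arcs G" and "(head G f, v) \<in> (arc_rel (arcs G))\<^sup>*"
    unfolding ancestors_def by auto
  then obtain q where q: "awalk (head G f) q v" using reach_iff_awalk head_in_verts by blast
  obtain p0 where "awalk s p0 (tail G f)" using U fa by (meson tail_in_verts)
  then have "awalk s (p0 @ f # q) v" using q fa by (intro awalk_appendI) (auto simp: awalk_Cons_iff)
  then have "p = p0 @ f # q" using p unique_awalkD by blast
  then show "f \<in> set p" by simp
next
  fix f assume "f \<in> set p"
  then obtain p0 q where pq: "p = p0 @ f # q" by (meson split_list)
  then have fa: "f \<in> arcs G" "awalk (head G f) q v" using p by (auto simp: awalk_Cons_iff)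
  then show "f \<in> ancestors (arcs G) v"
    unfolding ancestors_def using reach_iff_awalk[OF head_in_verts[OF fa(1)]] by auto
qed

text \<open>Shortening a walk to a path keeps its ends, so by uniqueness it returns the same
  walk.\<close>

lemma unique_awalk_apath:
  assumes "awalk s p v"
  shows "apath s p v"
proof -
  have "apath s (awalk_to_apath p) v" using assms by (rule apath_awalk_to_apath)
  moreover from this have "awalk_to_apath p = p"
    using assms by (blast intro: unique_awalkD awalkI_apath)
  ultimately show ?thesis by simp
qed

text \<open>Prefixing \<open>P2\<close>, and \<open>P1\<close> without its last arc
  \<open>e\<close>, by the walk \<open>Q\<close> from \<open>s\<close> to \<open>u\<close> gives the
  walks to the two ends of \<open>e\<close>; their common part \<open>Q\<close> cancels in the
  differences.\<close>

lemma path_pair_sets: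
  assumes e: "tail G e \<in> verts G" "head G e \<in> verts G" "e \<notin> arcs G"
    and pp: "path_pair G e u P1 P2"
  shows "set P1 = insert e (ancestors (arcs G) (tail G e)) - ancestors (arcs G) (head G e)"
    and "set P2 = ancestors (arcs G) (head G e) - insert e (ancestors (arcs G) (tail G e))"
proof -
  note P = pp[unfolded path_pair_conv[OF e(1,2)]]
  have ne: "P1 \<noteq> []" using P by auto
  have "tl (awalk_verts u P1) = map (head G) P1"
    using awalk_verts_conv'[of u P1 "head G e"] P ne by simp
  \<comment> \<open>The starting vertex is left out, so a closed \<open>P1\<close> is covered as
    well. Only one arc of \<open>P1\<close> can then end at \<open>head G e\<close>, which forces
    \<open>e\<close> to be the last.\<close>
  then have dh: "distinct (map (head G) P1)" using P distinct_tl by metis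
  have "head G (last P1) = head G e" using cas_last[OF _ ne] P by blast
  then have el: "last P1 = e" using dh P ne by (auto simp: distinct_map inj_on_def)
  define a where "a = butlast P1"
  have P1: "P1 = a @ [e]" unfolding a_def using el ne by auto
  have "e \<notin> set a" using dh unfolding P1 by auto
  then have a: "awalk u a (tail G e)" using P unfolding P1 awalk_def by (auto simp: awlast_if_cas)
  have P2: "awalk u P2 (head G e)" using P unfolding awalk_def by auto
  obtain Q where Q: "awalk s Q u" using U P by blast
  have Qa: "awalk s (Q @ a) (tail G e)" and QP2: "awalk s (Q @ P2) (head G e)"
    using awalk_appendI Q a P2 by blast+
  have "distinct (Q @ a)" "distinct (Q @ P2)"
    using unique_awalk_apath[OF Qa] unique_awalk_apath[OF QP2] distinct_verts_imp_distinct
    unfolding apath_def by blast+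
  moreover have "e \<notin> set Q" using Q e unfolding awalk_def by blast
  ultimately show "set P1 = insert e (ancestors (arcs G) (tail G e)) - ancestors (arcs G) (head G e)"
    and "set P2 = ancestors (arcs G) (head G e) - insert e (ancestors (arcs G) (tail G e))"
    unfolding ancestors_eq_set_awalk[OF Qa] ancestors_eq_set_awalk[OF QP2] using P P1 by auto
qed

text \<open>The walks from \<open>s\<close> to the two ends of \<open>e\<close> are split where they
  part, and that vertex serves as \<open>u\<close>.\<close>

lemma path_pair_exists:
  assumes e: "tail G e \<in> verts G" "head G e \<in> verts G" "e \<notin> arcs G"
  shows "\<exists>u P1 P2. path_pair G e u P1 P2"
proof -
  let ?w = "head G e"
  obtain \<alpha> \<beta> where \<alpha>: "awalk s \<alpha> (tail G e)" and \<beta>: "awalk s \<beta> ?w" using U e by meson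
  obtain Q a b where ab: "\<alpha> = Q @ a" "\<beta> = Q @ b" "a = [] \<or> b = [] \<or> hd a \<noteq> hd b"
    using common_prefix_split by blast
  define u where "u = awlast s Q"
  have Q: "awalk s Q u" and a: "awalk u a (tail G e)" and b: "awalk u b ?w"
    using \<alpha> \<beta> unfolding ab u_def by auto
  have pa: "apath u a (tail G e)" and pb: "apath u b ?w"
    using unique_awalk_apath[OF \<alpha>] unique_awalk_apath[OF \<beta>] unfolding ab u_def
    by (auto simp: apath_append_iff)
  \<comment> \<open>A shared arc would give two walks from \<open>s\<close> to its tail; by
    uniqueness they agree, although \<open>a\<close> and \<open>b\<close> differ in their first
    arcs.\<close>
  have disj: "set a \<inter> set b = {}"
  proof (rule ccontr)
    assume "set a \<inter> set b \<noteq> {}"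
    then obtain x where x: "x \<in> set a" "x \<in> set b" by blast
    obtain a1 a2 b1 b2 where d: "a = a1 @ x # a2" "b = b1 @ x # b2" using x by (meson split_list)
    have "awalk u a1 (tail G x)" "awalk u b1 (tail G x)"
      using a b unfolding d by (auto simp: awalk_Cons_iff)
    then have "awalk s (Q @ a1) (tail G x)" "awalk s (Q @ b1) (tail G x)"
      using Q awalk_appendI by blast+
    then have "Q @ a1 = Q @ b1" by (rule unique_awalkD)
    then show False using ab(3) d by (cases a1) auto
  qed
  have eb: "e \<notin> set b" using b e unfolding awalk_def by blast
  have ca: "cas u (a @ [e]) ?w" using a unfolding awalk_def by (auto simp: awlast_if_cas)
  have av: "awalk_verts u (a @ [e]) = awalk_verts u a @ [?w]"
    using awalk_verts_append_cas[OF ca] a by simp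
  have da: "distinct (awalk_verts u a)" using pa unfolding apath_def by blast
  have "distinct (awalk_verts u (a @ [e])) \<or> u = ?w \<and> distinct (tl (awalk_verts u (a @ [e])))"
  \<comment> \<open>If \<open>e\<close> leads back to a vertex of \<open>a\<close>, that vertex is
    \<open>u\<close>: then \<open>b\<close> is empty and the first path closes to a cycle.\<close>
  proof (cases "?w \<in> set (awalk_verts u a)")
    case True
    then obtain q c where qc: "a = q @ c" "awalk u q ?w" using awalk_decomp[OF a] by blast
    then have "awalk s (Q @ q) ?w" using Q awalk_appendI by blast
    then have "Q @ q = Q @ b" using U \<beta> e unfolding ab by blast
    then have "b = []" using qc ab(3) by (cases b) auto
    then have uw: "u = ?w" using b by (simp add: awalk_Nil_iff)
    have "awhd u a = u" using a by simp
    then obtain ys where ys: "awalk_verts u a = u # ys" by (cases "awalk_verts u a") auto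
    then have "distinct (tl (awalk_verts u (a @ [e])))" using da uw unfolding av by simp
    then show ?thesis using uw by blast
  next
    case False
    then show ?thesis using da unfolding av by simp
  qed
  then have "path_pair G e u (a @ [e]) b"
    unfolding path_pair_conv[OF e(1,2)] using a b pb ca disj eb
    unfolding awalk_def apath_def by auto
  then show ?thesis by blast
qed

lemma externally_active_iff:
  assumes "tail G e \<in> verts G" "head G e \<in> verts G"
  shows "externally_active r H G e \<longleftrightarrow> e \<in> arcs H - arcs G \<and>
     min_in r (insert e (ancestors (arcs G) (tail G e)) - ancestors (arcs G) (head G e))
              (ancestors (arcs G) (head G e) - insert e (ancestors (arcs G) (tail G e)))"
proof (cases "e \<in> arcs H - arcs G")
  case True
  then have e: "e \<notin> arcs G" by simp
  obtain u P1 P2 where pp: "path_pair G e u P1 P2" using path_pair_exists[OF assms e] by blast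
  have "(\<exists>u P1 P2. path_pair G e u P1 P2 \<and> min_in r (set P1) (set P2)) \<longleftrightarrow>
     min_in r (insert e (ancestors (arcs G) (tail G e)) - ancestors (arcs G) (head G e))
              (ancestors (arcs G) (head G e) - insert e (ancestors (arcs G) (tail G e)))"
    (is "?l \<longleftrightarrow> ?r")
  proof
    assume ?l
    then show ?r using path_pair_sets[OF assms e] by auto
  next
    assume ?r
    then show ?l using pp path_pair_sets[OF assms e pp] by metis
  qed
  then show ?thesis using True unfolding externally_active_def min_in_def[of r "set _"] by blast
qed (auto simp: externally_active_def)

end

end

text \<open>A spanning subgraph is determined by its arc set, so sums over arborescences can run
  over branchings.\<close>

lemma arborescence_iff:
  assumes G: "fin_digraph G" and s: "s \<in> verts G"
  shows "arborescence G s T \<longleftrightarrow>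
    (\<exists>S\<in>pre_digraph.branchings G {s} (arcs G). T = G\<lparr>arcs := S\<rparr>)"
proof -
  interpret fin_digraph G by fact
  have wf: "wf_digraph (G\<lparr>arcs := S\<rparr>)" if "S \<subseteq> arcs G" for S
    by standard (use that in auto)
  have br: "pre_digraph.branchings (G\<lparr>arcs := S\<rparr>) {s} S = branchings {s} S" for S
    by (simp add: pre_digraph.branchings_def pre_digraph.arc_rel_def)
  have br': "S \<in> branchings {s} (arcs G) \<longleftrightarrow> S \<in> branchings {s} S" if "S \<subseteq> arcs G" for S
    using that by (auto simp: branchings_def)
  have eq: "forest (G\<lparr>arcs := S\<rparr>) \<and> (\<forall>v\<in>verts G. \<exists>!p. pre_digraph.apath (G\<lparr>arcs := S\<rparr>) s p v)
      \<longleftrightarrow> S \<in> branchings {s} (arcs G)" if S: "S \<subseteq> arcs G" for S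
    using wf_digraph.forest_unique_apath_iff[OF wf[OF S], of s]
      wf_digraph.unique_awalk_iff_branching[OF wf[OF S], of s] s
    by (simp add: br br'[OF S])
  have sp: "spanning T G \<longleftrightarrow> (\<exists>S\<subseteq>arcs G. T = G\<lparr>arcs := S\<rparr>)"
  proof
    assume "spanning T G"
    then have "T = G\<lparr>arcs := arcs T\<rparr>" "arcs T \<subseteq> arcs G"
      unfolding spanning_def subgraph_def compatible_def by auto
    then show "\<exists>S\<subseteq>arcs G. T = G\<lparr>arcs := S\<rparr>" by blast
  next
    assume "\<exists>S\<subseteq>arcs G. T = G\<lparr>arcs := S\<rparr>"
    then show "spanning T G"
      unfolding spanning_def subgraph_def compatible_def using wf wf_digraph by auto
  qed
  show ?thesis
  proof
    assume T: "arborescence G s T"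
    then obtain S where S: "S \<subseteq> arcs G" "T = G\<lparr>arcs := S\<rparr>" unfolding arborescence_def sp by blast
    then show "\<exists>S\<in>branchings {s} (arcs G). T = G\<lparr>arcs := S\<rparr>"
      using T eq[OF S(1)] unfolding arborescence_def by blast
  next
    assume "\<exists>S\<in>branchings {s} (arcs G). T = G\<lparr>arcs := S\<rparr>"
    then obtain S where S: "S \<in> branchings {s} (arcs G)" "T = G\<lparr>arcs := S\<rparr>" by blast
    show "arborescence G s T"
      using eq[OF branchingsD(1)[OF S(1)]] S branchingsD(1)[OF S(1)]
      unfolding arborescence_def sp by blast
  qed
qed

text \<open>An arc outside \<open>S\<close> is either active or inactive, and \<open>S\<close> has
  \<open>card (verts G) - 1\<close> arcs because \<open>head G\<close> maps it bijectively onto the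
  vertices other than \<open>s\<close>.\<close>

lemma ext_activity_eq:
  assumes G: "fin_digraph G" and s: "s \<in> verts G" and r: "linear_order_on (arcs G) r"
    and S: "S \<in> pre_digraph.branchings G {s} (arcs G)"
  shows "ext_activity r G (G\<lparr>arcs := S\<rparr>) =
     card (arcs G) - (card (verts G) - 1) - card (pre_digraph.inactives G r (arcs G) S)"
proof -
  interpret fin_digraph G by fact
  have SG: "S \<subseteq> arcs G" using branchingsD(1)[OF S] .
  have finS: "finite S" using finite_subset[OF SG] by simp
  let ?T = "G\<lparr>arcs := S\<rparr>"
  interpret T: wf_digraph ?T by standard (use SG in auto)
  have "S \<in> branchings {s} S" using S by (auto simp: branchings_def)
  then have U: "\<forall>v\<in>verts ?T. \<exists>!p. T.awalk s p v"
    using T.unique_awalk_iff_branching[of s] s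
    by (simp add: pre_digraph.branchings_def pre_digraph.arc_rel_def)
  have anc: "T.ancestors S = ancestors S"
    by (simp add: pre_digraph.ancestors_def pre_digraph.arc_rel_def fun_eq_iff)
  have "externally_active r G ?T e \<longleftrightarrow> e \<in> arcs G - S \<and> \<not> inactive r S e" for e
  proof (cases "e \<in> arcs G - S")
    case True
    let ?A1 = "insert e (ancestors S (tail G e))" and ?A2 = "ancestors S (head G e)"
    have sub: "?A1 \<union> ?A2 \<subseteq> arcs G" using True ancestors_subset SG by blast
    have eA: "e \<in> ?A1 - ?A2" using True ancestors_subset by blast
    have "externally_active r G ?T e \<longleftrightarrow> min_in r (?A1 - ?A2) (?A2 - ?A1)"
      using T.externally_active_iff[of s e r G] True s U by (simp add: anc)
    also have "\<dots> \<longleftrightarrow> \<not> min_in r (?A2 - ?A1) (?A1 - ?A2)"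
    proof (rule min_in_swap[OF r])
      show "finite ((?A1 - ?A2) \<union> (?A2 - ?A1))"
        by (rule finite_subset[OF _ finite_arcs]) (use sub in blast)
    qed (use sub eA in auto)
    finally show ?thesis using True unfolding inactive_def by blast
  qed (auto simp: externally_active_def)
  then have "{e. externally_active r G ?T e} = (arcs G - S) - inactives r (arcs G) S"
    unfolding inactives_def by blast
  moreover have "inactives r (arcs G) S \<subseteq> arcs G - S" unfolding inactives_def by blast
  ultimately have "ext_activity r G ?T = card (arcs G) - card S - card (inactives r (arcs G) S)"
    unfolding ext_activity_def using SG finS
    by (simp add: card_Diff_subset finite_subset[OF _ finite_Diff[OF finite_arcs]])
  moreover have "card S = card (verts G - {s})"
  proof (rule bij_betw_same_card[of "head G"], unfold bij_betw_def, intro conjI equalityI subsetI)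
    show "inj_on (head G) S" using S unfolding branchings_def by blast
    fix v
    show "v \<in> head G ` S" if v: "v \<in> verts G - {s}"
    proof -
      obtain b where b: "b \<in> {s}" "(b, v) \<in> (arc_rel S)\<^sup>*" using branchingsD(4)[OF S] v by blast
      from b(2) show ?thesis using b(1) v by (cases rule: rtranclE) (auto elim: arc_relE)
    qed
    show "v \<in> verts G - {s}" if "v \<in> head G ` S"
      using that branchingsD(2)[OF S] SG by auto
  qed
  ultimately show ?thesis using s by simp
qed

lemma greedoid_tutte_poly_eq:
  assumes G: "fin_digraph G" and s: "s \<in> verts G" and r: "linear_order_on (arcs G) r"
  shows "greedoid_tutte_poly r G s = (\<Sum>p\<in>pre_digraph.parking G {s} (arcs G).
     monom 1 (card (arcs G) - (card (verts G) - 1) - sum p (verts G)))"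
proof -
  interpret fin_digraph G by fact
  have "greedoid_tutte_poly r G s =
     (\<Sum>S\<in>branchings {s} (arcs G). monom 1 (ext_activity r G (G\<lparr>arcs := S\<rparr>)))"
    unfolding greedoid_tutte_poly_def arborescence_iff[OF G s]
  proof (rule sum.reindex_bij_witness[of _ "\<lambda>S. G\<lparr>arcs := S\<rparr>" arcs])
  qed auto
  also have "\<dots> = (\<Sum>S\<in>branchings {s} (arcs G).
     monom 1 (card (arcs G) - (card (verts G) - 1) - card (inactives r (arcs G) S)))"
    by (intro sum.cong refl) (simp add: ext_activity_eq[OF G s r])
  also have "\<dots> = (\<Sum>p\<in>parking {s} (arcs G).
     monom 1 (card (arcs G) - (card (verts G) - 1) - sum p (verts G)))"
    by (rule branchings_parking_sum[OF r]) (use s in auto)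
  finally show ?thesis .
qed


section \<open>Recurrent configurations of Eulerian digraphs\<close>

lemma card_fibers:
  assumes "finite E" "finite A"
  shows "card {e \<in> E. f e \<in> A} = (\<Sum>v\<in>A. card {e \<in> E. f e = v})"
proof -
  have "{e \<in> E. f e \<in> A} = (\<Union>v\<in>A. {e \<in> E. f e = v})" by blast
  then show ?thesis using assms by (simp only:) (subst card_UN_disjoint, auto)
qed

text \<open>For burning and flooding, where the next vertex depends on the set reached so
  far.\<close>

lemma finite_grow_induct:
  assumes "finite V" "W \<subseteq> V" "P W"
    and step: "\<And>W'. W \<subseteq> W' \<Longrightarrow> W' \<subseteq> V \<Longrightarrow> W' \<noteq> V \<Longrightarrow> P W' \<Longrightarrow> \<exists>v\<in>V - W'. P (insert v W')"
  shows "P V"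
proof -
  have "P V" if "W \<subseteq> W'" "W' \<subseteq> V" "P W'" for W'
    using that
  proof (induction "card (V - W')" arbitrary: W' rule: less_induct)
    case less
    show ?case
    proof (cases "W' = V")
      case False
      then obtain v where v: "v \<in> V - W'" "P (insert v W')" using step less.prems by blast
      have "card (V - insert v W') < card (V - W')"
        using v assms(1) by (intro psubset_card_mono) auto
      then show ?thesis using less v by blast
    qed (use less in simp)
  qed
  then show ?thesis using assms(2,3) by blast
qed

locale eulerian_sandpile = fin_digraph +
  fixes s
  assumes conn: "Digraph_Component.connected G" and euler: "eulerian G" and s_in: "s \<in> verts G"
begin

abbreviation nonsink where "nonsink \<equiv> verts G - {s}"

abbreviation firing (infix \<open>\<leadsto>\<close> 50) where "c \<leadsto> d \<equiv> legal_firing G s c d"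
abbreviation firings (infix \<open>\<leadsto>*\<close> 50) where "c \<leadsto>* d \<equiv> (legal_firing G s)\<^sup>*\<^sup>* c d"

section \<open>Degrees and cuts\<close>

definition arcs_into :: "'a set \<Rightarrow> 'a \<Rightarrow> nat" where
  "arcs_into A v = (\<Sum>w\<in>A. num_arcs G w v)"

lemma arcs_into_eq_card:
  assumes "finite A"
  shows "arcs_into A v = card {x \<in> arcs G. head G x = v \<and> tail G x \<in> A}"
  using card_fibers[of "{x \<in> arcs G. head G x = v}" A "tail G"] assms
  unfolding arcs_into_def num_arcs_def by (simp add: conj_ac)

text \<open>Balance trades the out-degree for the in-degree, which can then be split according to
  the tails of the arcs.\<close>

lemma out_degree_eq_arcs_into:
  assumes "v \<in> verts G"
  shows "out_degree G v = arcs_into (verts G) v"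
proof -
  have "{x \<in> arcs G. head G x = v \<and> tail G x \<in> verts G} = in_arcs G v"
    unfolding in_arcs_def by auto
  then show ?thesis
    using assms euler unfolding eulerian_def in_degree_def by (simp add: arcs_into_eq_card)
qed

lemma arcs_into_insert:
  "finite A \<Longrightarrow> w \<notin> A \<Longrightarrow> arcs_into (insert w A) v = arcs_into A v + num_arcs G w v"
  unfolding arcs_into_def by simp

lemma arcs_into_compl:
  assumes "A \<subseteq> verts G" "v \<in> verts G"
  shows "arcs_into A v + arcs_into (verts G - A) v = out_degree G v"
  unfolding out_degree_eq_arcs_into[OF assms(2)] arcs_into_def
  using sum.subset_diff[OF assms(1) finite_verts, of "\<lambda>w. num_arcs G w v"] by simp

lemma out_degree_eq_sum:
  assumes "v \<in> verts G"
  shows "out_degree G v = (\<Sum>w\<in>verts G. num_arcs G v w)"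
proof -
  have "{x \<in> {x \<in> arcs G. tail G x = v}. head G x \<in> verts G} = out_arcs G v"
    unfolding out_arcs_def by auto
  then show ?thesis
    using card_fibers[of "{x \<in> arcs G. tail G x = v}" "verts G" "head G"]
    unfolding out_degree_def num_arcs_def by (simp add: conj_ac)
qed

lemma num_arcs_pos: "e \<in> arcs G \<Longrightarrow> 0 < num_arcs G (tail G e) (head G e)"
  unfolding num_arcs_def by (auto simp: card_gt_0_iff)

text \<open>By balance, as many arcs have their tail in \<open>A\<close> as have their head there.
  If none left \<open>A\<close>, the two sets of arcs would coincide and no arc would cross the cut
  in either direction, against connectedness.\<close>

lemma cut_arc:
  assumes A: "A \<subseteq> verts G" "A \<noteq> {}" "A \<noteq> verts G"
  shows "\<exists>e\<in>arcs G. tail G e \<in> A \<and> head G e \<notin> A"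
proof (rule ccontr)
  assume no: "\<not> ?thesis"
  have finA: "finite A" using A(1) by (rule finite_subset) simp
  have "card {e \<in> arcs G. tail G e \<in> A} = (\<Sum>v\<in>A. out_degree G v)"
    using card_fibers[OF finite_arcs finA, of "tail G"] unfolding out_degree_def out_arcs_def .
  also have "\<dots> = (\<Sum>v\<in>A. in_degree G v)"
    using euler A unfolding eulerian_def by (intro sum.cong) auto
  also have "\<dots> = card {e \<in> arcs G. head G e \<in> A}"
    using card_fibers[OF finite_arcs finA, of "head G"] unfolding in_degree_def in_arcs_def by simp
  finally have "{e \<in> arcs G. tail G e \<in> A} = {e \<in> arcs G. head G e \<in> A}"
    using no by (intro card_subset_eq) auto
  then have sym: "tail G e \<in> A \<longleftrightarrow> head G e \<in> A" if "e \<in> arcs G" for e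
    using that by blast
  obtain u w where uw: "u \<in> A" "w \<in> verts G" "w \<notin> A" using A by blast
  have "u \<rightarrow>\<^sup>*\<^bsub>with_proj (mk_symmetric G)\<^esub> w"
    using conn uw A unfolding connected_def strongly_connected_def
    by (auto simp: mk_symmetric_def)
  then have "(u, w) \<in> (arcs_ends (with_proj (mk_symmetric G)))\<^sup>*"
    unfolding reachable_def by (rule rtrancl_on_rtranclI)
  then have "w \<in> A"
  proof (induction rule: rtrancl_induct)
    case (step y z)
    then show ?case using sym by (auto simp: mk_symmetric_def arcs_ends_def arc_to_ends_def)
  qed (use uw in simp)
  then show False using uw by simp
qed

text \<open>No arc can leave the set of vertices that fail to reach \<open>s\<close>, against
  \<open>cut_arc\<close>.\<close>

lemma reach_sink:
  assumes "v \<in> verts G"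
  shows "(v, s) \<in> (arc_rel (arcs G))\<^sup>*"
proof (rule ccontr)
  assume no: "(v, s) \<notin> (arc_rel (arcs G))\<^sup>*"
  let ?A = "{v \<in> verts G. (v, s) \<notin> (arc_rel (arcs G))\<^sup>*}"
  have "?A \<subseteq> verts G" "?A \<noteq> {}" "?A \<noteq> verts G" using no assms s_in by auto
  then obtain e where e: "e \<in> arcs G" "tail G e \<in> ?A" "head G e \<notin> ?A" using cut_arc by blast
  then have "(head G e, s) \<in> (arc_rel (arcs G))\<^sup>*" by auto
  then have "(tail G e, s) \<in> (arc_rel (arcs G))\<^sup>*"
    using arc_relI[OF e(1)] by (rule converse_rtrancl_into_rtrancl[rotated])
  then show False using e by simp
qed

section \<open>Termination and confluence of legal firings\<close>

lemma rank_exists: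
  "\<exists>D :: 'a \<Rightarrow> nat. \<forall>v\<in>nonsink. \<exists>e\<in>arcs G. tail G e = v \<and> D (head G e) < D v"
proof (intro exI ballI)
  let ?R = "arc_rel (arcs G)"
  \<comment> \<open>The distance to the sink; the first arc of a shortest walk lowers it.\<close>
  let ?D = "\<lambda>v. LEAST n. (v, s) \<in> ?R ^^ n"
  fix v assume v: "v \<in> nonsink"
  have "\<exists>n. (v, s) \<in> ?R ^^ n" using reach_sink v by (auto dest: rtrancl_imp_relpow)
  then have *: "(v, s) \<in> ?R ^^ ?D v" by (rule LeastI_ex)
  then obtain m where m: "?D v = Suc m" using v by (cases "?D v") auto
  then obtain w where w: "(v, w) \<in> ?R" "(w, s) \<in> ?R ^^ m" using * by (metis relpow_Suc_D2)
  have "?D w \<le> m" using w(2) by (rule Least_le)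
  moreover obtain e where "e \<in> arcs G" "v = tail G e" "w = head G e" using w(1) by (rule arc_relE)
  ultimately show "\<exists>e\<in>arcs G. tail G e = v \<and> ?D (head G e) < ?D v" using m by auto
qed

text \<open>If every vertex off the sink has an arc to a vertex of smaller rank \<open>D\<close>, then
  \<open>M\<^bsup>N\<^esup> - M\<^bsup>N - D v\<^esup>\<close> is strictly superharmonic once \<open>M\<close> exceeds all degrees.\<close>

lemma potential_exists:
  "\<exists>h :: 'a \<Rightarrow> nat. \<forall>v\<in>nonsink. (\<Sum>w\<in>nonsink. num_arcs G v w * h w) < out_degree G v * h v"
proof -
  obtain D :: "'a \<Rightarrow> nat" where D: "\<And>v. v \<in> nonsink \<Longrightarrow> \<exists>e\<in>arcs G. tail G e = v \<and> D (head G e) < D v"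
    using rank_exists by blast
  define N where "N = Max (D ` verts G)"
  have DN: "D v \<le> N" if "v \<in> verts G" for v unfolding N_def using that by simp
  define M where "M = Suc (card (arcs G))"
  define k where "k v = M ^ (N - D v)" for v
  define h where "h v = M ^ N - k v" for v
  have hk: "h v + k v = M ^ N" for v
    unfolding h_def k_def M_def by (simp add: power_increasing)
  show ?thesis
  proof (intro exI ballI)
    fix v assume v: "v \<in> nonsink"
    obtain e where e: "e \<in> arcs G" "tail G e = v" "D (head G e) < D v" using D[OF v] by blast
    let ?w = "head G e"
    have wV: "?w \<in> verts G" using e by simp
    have deg: "out_degree G v = (\<Sum>w\<in>verts G. num_arcs G v w)" using out_degree_eq_sum v by simp
    have "out_degree G v \<le> card (arcs G)"
      unfolding out_degree_def out_arcs_def by (intro card_mono) auto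
    then have "out_degree G v < M" unfolding M_def by simp
    moreover have "0 < k v" unfolding k_def M_def by simp
    ultimately have "out_degree G v * k v < M * k v" by simp
    also have "\<dots> = M ^ Suc (N - D v)" unfolding k_def by simp
    \<comment> \<open>The truncated \<open>N - D v\<close> is exact because
      \<open>D v \<le> N\<close>, so \<open>D ?w < D v\<close> raises the exponent by at least
      one.\<close>
    also have "\<dots> \<le> k ?w" unfolding k_def
      using e(3) DN[of v] v by (intro power_increasing) (auto simp: M_def)
    also have "\<dots> \<le> num_arcs G v ?w * k ?w" using num_arcs_pos[OF e(1)] e(2) by simp
    also have "\<dots> \<le> (\<Sum>w\<in>verts G. num_arcs G v w * k w)"
      using wV by (intro member_le_sum[of ?w "verts G" "\<lambda>w. num_arcs G v w * k w"]) auto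
    finally have less: "out_degree G v * k v < (\<Sum>w\<in>verts G. num_arcs G v w * k w)" .
    have "(\<Sum>w\<in>verts G. num_arcs G v w * h w) + (\<Sum>w\<in>verts G. num_arcs G v w * k w) =
        (\<Sum>w\<in>verts G. num_arcs G v w * M ^ N)"
      unfolding sum.distrib[symmetric] by (simp add: hk flip: distrib_left)
    also have "\<dots> = out_degree G v * (h v + k v)" unfolding deg hk by (simp add: sum_distrib_right)
    finally have "(\<Sum>w\<in>verts G. num_arcs G v w * h w) < out_degree G v * h v"
      using less by (simp add: distrib_left)
    moreover have "(\<Sum>w\<in>nonsink. num_arcs G v w * h w) \<le> (\<Sum>w\<in>verts G. num_arcs G v w * h w)"
      by (intro sum_mono2) auto
    ultimately show "(\<Sum>w\<in>nonsink. num_arcs G v w * h w) < out_degree G v * h v" by simp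
  qed
qed

text \<open>The number of chips drops only when some reach the sink. Weighted by the superharmonic
  \<open>h\<close>, every firing loses more at \<open>v\<close> than it adds along the arcs of
  \<open>v\<close>.\<close>

lemma firing_measure:
  "\<exists>\<mu> :: ('a \<Rightarrow> nat) \<Rightarrow> nat. \<forall>c d. c \<leadsto> d \<longrightarrow> \<mu> d < \<mu> c"
proof -
  obtain h :: "'a \<Rightarrow> nat" where
    h: "\<And>v. v \<in> nonsink \<Longrightarrow> (\<Sum>w\<in>nonsink. num_arcs G v w * h w) < out_degree G v * h v"
    using potential_exists by blast
  show ?thesis
  proof (intro exI allI impI)
    fix c d assume "c \<leadsto> d"
    then obtain v where v: "v \<in> nonsink" "out_degree G v \<le> c v" "d = fire G s v c"
      unfolding legal_firing_def by blast
    have "d w * h w + (if w = v then out_degree G v * h v else 0) = c w * h w + num_arcs G v w * h w"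
      if "w \<in> nonsink" for w
      using v that unfolding fire_def by (auto simp: add_mult_distrib[symmetric])
    then have "(\<Sum>w\<in>nonsink. d w * h w + (if w = v then out_degree G v * h v else 0)) =
        (\<Sum>w\<in>nonsink. c w * h w + num_arcs G v w * h w)"
      by (intro sum.cong) auto
    then have "(\<Sum>w\<in>nonsink. d w * h w) + out_degree G v * h v =
        (\<Sum>w\<in>nonsink. c w * h w) + (\<Sum>w\<in>nonsink. num_arcs G v w * h w)"
      using v(1) by (simp add: sum.distrib)
    then show "(\<Sum>w\<in>nonsink. d w * h w) < (\<Sum>w\<in>nonsink. c w * h w)" using h[OF v(1)] by simp
  qed
qed

text \<open>Firing one vertex takes no chips from another, so the other firing stays legal and the
  two commute.\<close>

lemma firing_diamond:
  assumes "c \<leadsto> d" "c \<leadsto> d'"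
  shows "d = d' \<or> (\<exists>x. d \<leadsto> x \<and> d' \<leadsto> x)"
proof -
  obtain v w where v: "v \<in> nonsink" "out_degree G v \<le> c v" "d = fire G s v c"
    and w: "w \<in> nonsink" "out_degree G w \<le> c w" "d' = fire G s w c"
    using assms unfolding legal_firing_def by blast
  show ?thesis
  proof (cases "v = w")
    case False
    have "fire G s w d = fire G s v d'"
      unfolding v(3) w(3) using False v w by (auto simp: fire_def fun_eq_iff)
    moreover have "d \<leadsto> fire G s w d"
      unfolding legal_firing_def using w False v(3) by (intro bexI[of _ w]) (auto simp: fire_def)
    moreover have "d' \<leadsto> fire G s v d'"
      unfolding legal_firing_def using v False w(3) by (intro bexI[of _ v]) (auto simp: fire_def)
    ultimately show ?thesis by metis
  qed (use v w in simp)
qed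

lemma stable_no_firing: "stable G s c \<Longrightarrow> \<not> c \<leadsto> d"
  unfolding stable_def legal_firing_def by (meson leD)

lemma stable_firings_eq: "stable G s c \<Longrightarrow> c \<leadsto>* d \<Longrightarrow> d = c"
  by (metis converse_rtranclpE stable_no_firing)

text \<open>Newman's argument: the decreasing measure gives existence, and induction on it joins two
  firing sequences through the common successor \<open>x\<close> of their first steps.\<close>

lemma stabilization_ex1: "\<exists>!d. c \<leadsto>* d \<and> stable G s d"
proof -
  obtain \<mu> :: "('a \<Rightarrow> nat) \<Rightarrow> nat" where \<mu>: "\<And>c d. c \<leadsto> d \<Longrightarrow> \<mu> d < \<mu> c"
    using firing_measure by blast
  have ex: "\<exists>d. c \<leadsto>* d \<and> stable G s d" for c
  proof (induction "\<mu> c" arbitrary: c rule: less_induct)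
    case less
    show ?case
    proof (cases "stable G s c")
      case False
      then obtain v where "v \<in> nonsink" "out_degree G v \<le> c v" unfolding stable_def by fastforce
      then have c: "c \<leadsto> fire G s v c" unfolding legal_firing_def by blast
      then show ?thesis using less[OF \<mu>[OF c]] by (meson converse_rtranclp_into_rtranclp)
    qed blast
  qed
  have "d = d'" if "c \<leadsto>* d" "stable G s d" "c \<leadsto>* d'" "stable G s d'" for c d d'
    using that
  proof (induction "\<mu> c" arbitrary: c d d' rule: less_induct)
    case less
    show ?case
    proof (cases "stable G s c")
      case True
      then show ?thesis using less.prems stable_firings_eq by metis
    next
      case False
      then obtain e where e: "c \<leadsto> e" "e \<leadsto>* d" using less.prems by (metis converse_rtranclpE)
      obtain e' where e': "c \<leadsto> e'" "e' \<leadsto>* d'" using less.prems False by (metis converse_rtranclpE)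
      consider "e = e'" | x where "e \<leadsto> x" "e' \<leadsto> x" using firing_diamond[OF e(1) e'(1)] by blast
      then show ?thesis
      proof cases
        case 1
        then show ?thesis using less.hyps[OF \<mu>[OF e(1)]] e e' less.prems by blast
      next
        case 2
        obtain y where y: "x \<leadsto>* y" "stable G s y" using ex by blast
        have "e \<leadsto>* y" "e' \<leadsto>* y" using 2 y by (meson converse_rtranclp_into_rtranclp)+
        then have "d = y" "d' = y"
          using less.hyps[OF \<mu>[OF e(1)] e(2)] less.hyps[OF \<mu>[OF e'(1)] e'(2)] less.prems y by blast+
        then show ?thesis by simp
      qed
    qed
  qed
  then show ?thesis using ex by blast
qed

lemma stabilization_eqI: "c \<leadsto>* d \<Longrightarrow> stable G s d \<Longrightarrow> stabilization G s c = d"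
  unfolding stabilization_def using stabilization_ex1[of c] by (intro the1_equality) auto

lemma stabilization_props: "c \<leadsto>* stabilization G s c" "stable G s (stabilization G s c)"
  using theI'[OF stabilization_ex1[of c]] unfolding stabilization_def by auto

lemma stabilization_firings: "c \<leadsto>* d \<Longrightarrow> stabilization G s c = stabilization G s d"
  using stabilization_props[of d] by (intro stabilization_eqI) auto

lemma firings_add:
  assumes "c \<leadsto>* d" "b \<in> configs G s"
  shows "(\<lambda>v. c v + b v) \<leadsto>* (\<lambda>v. d v + b v)"
  using assms(1)
proof (induction rule: rtranclp_induct)
  case (step y z)
  then obtain v where v: "v \<in> nonsink" "out_degree G v \<le> y v" "z = fire G s v y"
    unfolding legal_firing_def by blast
  have "(\<lambda>v. z v + b v) = fire G s v (\<lambda>v. y v + b v)"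
    using v assms(2) unfolding fire_def configs_def fun_eq_iff by auto
  then have "(\<lambda>v. y v + b v) \<leadsto> (\<lambda>v. z v + b v)"
    unfolding legal_firing_def using v by (intro bexI[of _ v]) auto
  then show ?case using step.IH by simp
qed simp

lemma firings_configs: "c \<leadsto>* d \<Longrightarrow> c \<in> configs G s \<Longrightarrow> d \<in> configs G s"
  by (induction rule: rtranclp_induct) (auto simp: legal_firing_def fire_def configs_def)

lemma source_configs: "(\<lambda>v. k * source_config G s v) \<in> configs G s"
  unfolding configs_def source_config_def by auto

text \<open>Dhar's burning criterion; a set \<open>A\<close> violating it supports a forbidden subconfiguration.\<close>

definition burnable :: "('a \<Rightarrow> nat) \<Rightarrow> bool" where
  "burnable c \<longleftrightarrow> (\<forall>A. A \<noteq> {} \<longrightarrow> A \<subseteq> nonsink \<longrightarrow> (\<exists>v\<in>A. arcs_into A v \<le> c v))"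

section \<open>The burning algorithm\<close>

lemma burnableD:
  "burnable c \<Longrightarrow> A \<noteq> {} \<Longrightarrow> A \<subseteq> nonsink \<Longrightarrow> \<exists>v\<in>A. arcs_into A v \<le> c v"
  unfolding burnable_def by blast

text \<open>When \<open>w\<close> joins a test set, the bound at \<open>v\<close> grows by
  \<open>num_arcs G w v\<close>, exactly the chips that firing \<open>w\<close> sends to
  \<open>v\<close>; so the witness for \<open>A\<close> without \<open>w\<close> still serves. For
  \<open>A = {w}\<close> the chips returned by loops suffice.\<close>

lemma burnable_firing:
  assumes c: "burnable c" and "c \<leadsto> d"
  shows "burnable d"
proof -
  obtain w where w: "w \<in> nonsink" "out_degree G w \<le> c w" "d = fire G s w c"
    using assms(2) unfolding legal_firing_def by blast
  have "\<exists>v\<in>A. arcs_into A v \<le> d v" if A: "A \<noteq> {}" "A \<subseteq> nonsink" for A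
  proof (cases "w \<in> A")
    case False
    obtain v where "v \<in> A" "arcs_into A v \<le> c v" using c A unfolding burnable_def by blast
    then show ?thesis using False A unfolding w(3) fire_def by (intro bexI[of _ v]) auto
  next
    case True
    then obtain A' where A': "A = insert w A'" "w \<notin> A'" by (meson mk_disjoint_insert)
    have fin: "finite A'" using A A' finite_subset[of A "verts G"] by auto
    show ?thesis
    proof (cases "A' = {}")
      case True
      then show ?thesis using A' A w(1) unfolding w(3) fire_def arcs_into_def by auto
    next
      case False
      then obtain v where v: "v \<in> A'" "arcs_into A' v \<le> c v"
        using c A A' unfolding burnable_def by blast
      then have "v \<noteq> w" "v \<in> nonsink" using A A' by auto
      then have "arcs_into A v \<le> d v"
        using v unfolding A'(1) arcs_into_insert[OF fin A'(2)] w(3) fire_def by simp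
      then show ?thesis using v A' by blast
    qed
  qed
  then show ?thesis unfolding burnable_def by blast
qed

lemma burnable_firings: "c \<leadsto>* d \<Longrightarrow> burnable c \<Longrightarrow> burnable d"
  by (induction rule: rtranclp_induct) (auto intro: burnable_firing)

lemma burning:
  assumes c: "c \<in> configs G s" "burnable c"
  shows "(\<lambda>v. c v + source_config G s v) \<leadsto>* c"
proof -
  \<comment> \<open>The configuration after every vertex of \<open>B\<close> has fired once, where
    adding \<open>source_config\<close> counts as the firing of \<open>s\<close>.\<close>
  define fired where "fired B w = (if w \<in> nonsink
    then c w + arcs_into B w - (if w \<in> B then out_degree G w else 0) else 0)" for B w
  \<comment> \<open>The second conjunct keeps the truncated subtraction in \<open>fired\<close>
    exact.\<close>
  define P where "P B \<longleftrightarrow> (\<lambda>v. c v + source_config G s v) \<leadsto>* fired B \<and>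
    (\<forall>v\<in>B - {s}. out_degree G v \<le> c v + arcs_into B v)" for B
  have "P (verts G)"
  proof (rule finite_grow_induct[OF finite_verts, of "{s}" P])
    have "fired {s} = (\<lambda>v. c v + source_config G s v)"
      using c(1) unfolding fired_def source_config_def arcs_into_def configs_def by auto
    then show "P {s}" unfolding P_def by simp
  next
    fix B assume B: "{s} \<subseteq> B" "B \<subseteq> verts G" "B \<noteq> verts G" "P B"
    have finB: "finite B" using B(2) by (rule finite_subset) simp
    have "verts G - B \<noteq> {}" using B(2,3) by blast
    moreover have "verts G - B \<subseteq> nonsink" using B(1) by blast
    \<comment> \<open>The set of vertices yet to fire is tested. By \<open>arcs_into_compl\<close>,
      the vertex found has received enough from \<open>B\<close> to be fired.\<close>
    ultimately obtain v where v: "v \<in> verts G - B" "arcs_into (verts G - B) v \<le> c v"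
      using burnableD[OF c(2), of "verts G - B"] by blast
    have vB: "v \<notin> B" "v \<in> nonsink" using v(1) B(1) by auto
    have deg: "out_degree G v \<le> c v + arcs_into B v" using arcs_into_compl[OF B(2), of v] v by simp
    have old: "out_degree G w \<le> c w + arcs_into B w" if "w \<in> B" "w \<noteq> s" for w
      using B(4) that unfolding P_def by blast
    have "fire G s v (fired B) = fired (insert v B)"
    proof
      fix w
      show "fire G s v (fired B) w = fired (insert v B) w"
        using vB deg old[of w] unfolding fire_def fired_def arcs_into_insert[OF finB vB(1)] by auto
    qed
    moreover have "fired B \<leadsto> fire G s v (fired B)"
      unfolding legal_firing_def using vB deg by (intro bexI[of _ v]) (auto simp: fired_def)
    moreover have "out_degree G w \<le> c w + arcs_into (insert v B) w" if "w \<in> insert v B - {s}" for w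
      using that deg old[of w] unfolding arcs_into_insert[OF finB vB(1)] by auto
    ultimately have "P (insert v B)"
      using B(4) unfolding P_def by (auto intro: rtranclp.rtrancl_into_rtrancl)
    then show "\<exists>v\<in>verts G - B. P (insert v B)" using v by blast
  qed (use s_in in auto)
  \<comment> \<open>By balance each vertex has received \<open>out_degree\<close> many chips and
    spent as many.\<close>
  moreover have "fired (verts G) = c"
    using c(1) unfolding fired_def configs_def by (auto simp: fun_eq_iff out_degree_eq_arcs_into)
  ultimately show ?thesis unfolding P_def by simp
qed

lemma burning_multiple:
  assumes c: "c \<in> configs G s" "burnable c"
  shows "(\<lambda>v. c v + k * source_config G s v) \<leadsto>* c"
proof (induction k)
  case (Suc k)
  have "(\<lambda>v. c v + Suc k * source_config G s v) =
      (\<lambda>v. (c v + source_config G s v) + k * source_config G s v)" by auto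
  then show ?case
    using firings_add[OF burning[OF c] source_configs[of k]] Suc by (metis rtranclp_trans)
qed simp

lemma fire_many:
  assumes "w \<in> nonsink" "M * out_degree G w \<le> d w"
  shows "\<exists>d'. d \<leadsto>* d' \<and> d w \<le> d' w + M * out_degree G w \<and>
    (\<forall>v\<in>nonsink. v \<noteq> w \<longrightarrow> d v + M * num_arcs G w v \<le> d' v)"
  using assms(2)
proof (induction M arbitrary: d)
  case (Suc M)
  let ?e = "fire G s w d"
  have step: "d \<leadsto> ?e" unfolding legal_firing_def using assms(1) Suc.prems by (intro bexI[of _ w]) auto
  have ew: "d w \<le> ?e w + out_degree G w" using assms(1) Suc.prems unfolding fire_def by auto
  then have "M * out_degree G w \<le> ?e w" using Suc.prems by simp
  then obtain d' where d': "?e \<leadsto>* d'" "?e w \<le> d' w + M * out_degree G w"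
    "\<forall>v\<in>nonsink. v \<noteq> w \<longrightarrow> ?e v + M * num_arcs G w v \<le> d' v" using Suc.IH by blast
  have "d \<leadsto>* d'" using step d'(1) by (rule converse_rtranclp_into_rtranclp)
  moreover have "d w \<le> d' w + Suc M * out_degree G w" using ew d'(2) by simp
  moreover have "d v + Suc M * num_arcs G w v \<le> d' v" if "v \<in> nonsink" "v \<noteq> w" for v
    using d'(3) that unfolding fire_def by force
  ultimately show ?case by blast
qed auto

text \<open>Chips spread from the sink across cut arcs. The next vertex is filled by more copies of
  the source configuration if the arc starts at \<open>s\<close>, and by repeated firing of its tail
  otherwise.\<close>

lemma flooding:
  "\<exists>k d. (\<lambda>v. k * source_config G s v) \<leadsto>* d \<and> (\<forall>v\<in>nonsink. M \<le> d v)"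
proof -
  \<comment> \<open>\<open>M\<close> is quantified inside \<open>P\<close> because filling a new
    vertex spends chips at the tail, so the hypothesis is needed for a larger bound.\<close>
  define P where "P W \<longleftrightarrow>
    (\<forall>M. \<exists>k d. (\<lambda>v. k * source_config G s v) \<leadsto>* d \<and> (\<forall>v\<in>W - {s}. M \<le> d v))" for W
  have "P (verts G)"
  proof (rule finite_grow_induct[OF finite_verts, of "{s}" P])
    show "P {s}" unfolding P_def by auto
  next
    fix W assume W: "{s} \<subseteq> W" "W \<subseteq> verts G" "W \<noteq> verts G" "P W"
    then obtain e where e: "e \<in> arcs G" "tail G e \<in> W" "head G e \<notin> W" using cut_arc by blast
    let ?w = "tail G e" and ?v = "head G e"
    have v: "?v \<in> nonsink" using e W by auto
    have pos: "1 \<le> num_arcs G ?w ?v" using num_arcs_pos[OF e(1)] by simp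
    have "\<exists>k d. (\<lambda>v. k * source_config G s v) \<leadsto>* d \<and> (\<forall>v\<in>insert ?v W - {s}. M \<le> d v)" for M
    proof (cases "?w = s")
      case True
      obtain k d where d: "(\<lambda>v. k * source_config G s v) \<leadsto>* d" "\<forall>v\<in>W - {s}. M \<le> d v"
        using W(4) unfolding P_def by blast
      have "(\<lambda>v. (k + M) * source_config G s v) \<leadsto>* (\<lambda>v. d v + M * source_config G s v)"
        using firings_add[OF d(1) source_configs[of M]] by (simp add: distrib_right)
      moreover have "M \<le> d ?v + M * source_config G s ?v"
        using pos v True unfolding source_config_def by (simp add: trans_le_add2)
      ultimately show ?thesis using d(2) by (intro exI conjI) (auto intro: trans_le_add1)
    next
      case False
      \<comment> \<open>\<open>M\<close> firings of \<open>?w\<close> cost the second summand and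
        give \<open>?v\<close> at least \<open>M\<close> chips; the first summand stays
        behind.\<close>
      let ?M = "M + M * out_degree G ?w"
      obtain k d where d: "(\<lambda>v. k * source_config G s v) \<leadsto>* d" "\<forall>v\<in>W - {s}. ?M \<le> d v"
        using W(4) unfolding P_def by blast
      have w: "?w \<in> nonsink" using False e by simp
      have dw: "?M \<le> d ?w" using d e False by simp
      then obtain d' where d': "d \<leadsto>* d'" "d ?w \<le> d' ?w + M * out_degree G ?w"
        "\<forall>v\<in>nonsink. v \<noteq> ?w \<longrightarrow> d v + M * num_arcs G ?w v \<le> d' v"
        using fire_many[OF w, of M d] by auto
      have "M \<le> d' x" if x: "x \<in> insert ?v W - {s}" for x
      proof -
        consider "x = ?w" | "x = ?v" "x \<noteq> ?w" | "x \<in> W - {s}" "x \<noteq> ?w" using x by blast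
        then show ?thesis
        proof cases
          case 1
          then show ?thesis using d'(2) dw by simp
        next
          case 2
          have "M \<le> M * num_arcs G ?w ?v" using pos by simp
          also have "\<dots> \<le> d' ?v" using d'(3) v 2 by (meson add_leD2)
          finally show ?thesis using 2 by simp
        next
          case 3
          then have "?M \<le> d x" "d x + M * num_arcs G ?w x \<le> d' x" using d(2) d'(3) W by auto
          then show ?thesis by simp
        qed
      qed
      moreover have "(\<lambda>v. k * source_config G s v) \<leadsto>* d'" using d(1) d'(1) by simp
      ultimately show ?thesis by blast
    qed
    then have "P (insert ?v W)" unfolding P_def by blast
    then show "\<exists>v\<in>verts G - W. P (insert v W)" using v e by blast
  qed (use s_in in auto)
  then show ?thesis unfolding P_def by blast
qed

text \<open>A configuration with at least \<open>out_degree\<close> many chips everywhere is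
  burnable, and firing preserves this. Conversely, every \<open>c1\<close> lies below some
  \<open>d\<close> reachable from copies of the source configuration, and adding such copies to
  \<open>c\<close> does not change its stabilization.\<close>

lemma Rec_iff: "c \<in> Rec G s \<longleftrightarrow> c \<in> configs G s \<and> stable G s c \<and> burnable c"
proof
  assume c: "c \<in> Rec G s"
  define c1 where "c1 v = (if v \<in> nonsink then out_degree G v else 0)" for v
  have "c1 \<in> configs G s" unfolding c1_def configs_def by auto
  then obtain c2 where c2: "stabilization G s (\<lambda>v. c1 v + c2 v) = c"
    using c unfolding Rec_def by blast
  have "burnable (\<lambda>v. c1 v + c2 v)"
    unfolding burnable_def
  proof (intro allI impI)
    fix A assume A: "A \<noteq> {}" "A \<subseteq> nonsink"
    then obtain v where v: "v \<in> A" by blast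
    have AV: "A \<subseteq> verts G" "v \<in> nonsink" using A v by auto
    then have "arcs_into A v \<le> c1 v"
      using arcs_into_compl[of A v] unfolding c1_def by auto
    then show "\<exists>v\<in>A. arcs_into A v \<le> c1 v + c2 v" using v trans_le_add1 by blast
  qed
  then have "burnable c" using burnable_firings stabilization_props(1) c2 by blast
  then show "c \<in> configs G s \<and> stable G s c \<and> burnable c"
    using c stabilization_props(2) c2 unfolding Rec_def by blast
next
  assume c: "c \<in> configs G s \<and> stable G s c \<and> burnable c"
  have "\<exists>c2\<in>configs G s. stabilization G s (\<lambda>v. c1 v + c2 v) = c" if c1: "c1 \<in> configs G s" for c1
  proof -
    \<comment> \<open>The total of \<open>c1\<close> serves as one bound for all its values.\<close>
    obtain k d where d: "(\<lambda>v. k * source_config G s v) \<leadsto>* d" "\<forall>v\<in>nonsink. sum c1 (verts G) \<le> d v"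
      using flooding by blast
    have dc: "d \<in> configs G s" using firings_configs[OF d(1) source_configs] .
    have le: "c1 v \<le> d v" for v
    proof (cases "v \<in> nonsink")
      case True
      then have "c1 v \<le> sum c1 (verts G)" by (intro member_le_sum) auto
      then show ?thesis using d(2) True by (meson le_trans)
    qed (use c1 in \<open>auto simp: configs_def\<close>)
    define c2 where "c2 v = d v + c v - c1 v" for v
    have "c2 \<in> configs G s" using dc c unfolding c2_def configs_def by auto
    moreover have "stabilization G s (\<lambda>v. c1 v + c2 v) = c"
    proof -
      have "(\<lambda>v. c1 v + c2 v) = (\<lambda>v. d v + c v)" using le unfolding c2_def by (simp add: fun_eq_iff trans_le_add1)
      moreover have "(\<lambda>v. c v + k * source_config G s v) \<leadsto>* (\<lambda>v. d v + c v)"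
        using firings_add[OF d(1), of c] c by (simp add: add.commute)
      ultimately have "stabilization G s (\<lambda>v. c1 v + c2 v) =
          stabilization G s (\<lambda>v. c v + k * source_config G s v)"
        using stabilization_firings by metis
      also have "\<dots> = c" using burning_multiple c by (intro stabilization_eqI) auto
      finally show ?thesis .
    qed
    ultimately show ?thesis by blast
  qed
  then show "c \<in> Rec G s" using c unfolding Rec_def by blast
qed

lemma rec_rel_eq_Id_on: "rec_rel G s = Id_on (Rec G s)"
proof -
  have "stabilization G s (\<lambda>v. c v + k * source_config G s v) = c" if "c \<in> Rec G s" for c k
    using that burning_multiple by (intro stabilization_eqI) (auto simp: Rec_iff)
  then show ?thesis unfolding rec_rel_def by auto
qed

section \<open>From recurrent configurations to parking functions\<close>

lemma biggs_merino_poly_eq_sum_Rec: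
  "biggs_merino_poly G s = (\<Sum>c\<in>Rec G s. monom 1 (dlvl G s c))"
proof -
  have "Rec G s // rec_rel G s = (\<lambda>c. {c}) ` Rec G s"
    unfolding rec_rel_eq_Id_on quotient_def by auto
  then show ?thesis
    unfolding biggs_merino_poly_def by (simp add: sum.reindex class_dlvl_def)
qed

text \<open>On stable configurations this is an involution, so it serves in both directions between
  recurrent configurations and parking functions.\<close>

definition stable_compl :: "('a \<Rightarrow> nat) \<Rightarrow> 'a \<Rightarrow> nat" where
  "stable_compl c v = (if v \<in> nonsink then out_degree G v - 1 - c v else 0)"

text \<open>Exchanges the burning bound \<open>arcs_into A v <= c v\<close> for the parking bound on
  \<open>out_degree G v - 1 - c v\<close>; the strictness of the latter accounts for the 1.\<close>

lemma card_arcs_from_compl: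
  assumes "A \<subseteq> verts G" "v \<in> verts G"
  shows "arcs_into A v + card {x \<in> arcs G. head G x = v \<and> tail G x \<notin> A} = out_degree G v"
proof -
  have "{x \<in> arcs G. head G x = v \<and> tail G x \<notin> A} = {x \<in> arcs G. head G x = v \<and> tail G x \<in> verts G - A}"
    by auto
  then show ?thesis using arcs_into_compl[OF assms] arcs_into_eq_card[of "verts G - A" v] by simp
qed

lemma stable_compl_parking:
  assumes c: "c \<in> Rec G s"
  shows "stable_compl c \<in> parking {s} (arcs G)" "stable_compl (stable_compl c) = c"
proof -
  have st: "c v < out_degree G v" if "v \<in> nonsink" for v
    using c that unfolding Rec_iff stable_def by blast
  have "\<exists>v\<in>A. stable_compl c v < card {x \<in> arcs G. head G x = v \<and> tail G x \<notin> A}"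
    if A: "A \<noteq> {}" "A \<subseteq> nonsink" for A
  proof -
    obtain v where v: "v \<in> A" "arcs_into A v \<le> c v" using c A unfolding Rec_iff burnable_def by blast
    have AV: "A \<subseteq> verts G" "v \<in> nonsink" using A v by auto
    then have "stable_compl c v < card {x \<in> arcs G. head G x = v \<and> tail G x \<notin> A}"
      using card_arcs_from_compl[of A v] st[of v] v unfolding stable_compl_def by auto
    then show ?thesis using v(1) by (intro bexI[of _ v])
  qed
  then show "stable_compl c \<in> parking {s} (arcs G)"
    unfolding parking_def by (simp add: stable_compl_def)
  show "stable_compl (stable_compl c) = c"
  proof
    fix v
    show "stable_compl (stable_compl c) v = c v"
    proof (cases "v \<in> nonsink")
      case True
      then show ?thesis using st[OF True] unfolding stable_compl_def by simp
    next
      case False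
      then show ?thesis using c unfolding stable_compl_def Rec_def configs_def by auto
    qed
  qed
qed

text \<open>The test set \<open>{v}\<close> yields this bound, which keeps the truncated subtraction
  in \<open>stable_compl\<close> exact.\<close>

lemma parking_less_out_degree:
  assumes "p \<in> parking {s} (arcs G)" "v \<in> nonsink"
  shows "p v < out_degree G v"
  using parking_less[OF assms] card_arcs_from_compl[of "{v}" v] assms(2) by simp

lemma stable_compl_Rec:
  assumes p: "p \<in> parking {s} (arcs G)"
  shows "stable_compl p \<in> Rec G s" "stable_compl (stable_compl p) = p"
proof -
  note lt = parking_less_out_degree[OF p]
  have "stable_compl p \<in> configs G s" unfolding stable_compl_def configs_def by auto
  moreover have "stable G s (stable_compl p)"
    unfolding stable_compl_def stable_def
  proof
    fix v assume v: "v \<in> nonsink"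
    show "(if v \<in> nonsink then out_degree G v - 1 - p v else 0) < out_degree G v" using lt[OF v] by simp
  qed
  moreover have "\<exists>v\<in>A. arcs_into A v \<le> stable_compl p v" if A: "A \<noteq> {}" "A \<subseteq> nonsink" for A
  proof -
    obtain v where v: "v \<in> A" "p v < card {x \<in> arcs G. head G x = v \<and> tail G x \<notin> A}"
      using parkingD(2)[OF p A] by blast
    have AV: "A \<subseteq> verts G" "v \<in> nonsink" using A v by auto
    then have "arcs_into A v \<le> stable_compl p v"
      using card_arcs_from_compl[of A v] v(2) unfolding stable_compl_def by auto
    then show ?thesis using v(1) by blast
  qed
  ultimately show "stable_compl p \<in> Rec G s" unfolding Rec_iff burnable_def by blast
  show "stable_compl (stable_compl p) = p"
  proof
    fix v
    show "stable_compl (stable_compl p) v = p v"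
    proof (cases "v \<in> nonsink")
      case True
      then show ?thesis using lt[OF True] unfolding stable_compl_def by simp
    next
      case False
      then show ?thesis using parkingD(1)[OF p False] unfolding stable_compl_def by auto
    qed
  qed
qed

text \<open>The out-degrees add up to the number of arcs. Off the sink each splits into
  \<open>c v\<close>, the complement and 1, and these ones make up
  \<open>card (verts G) - 1\<close>.\<close>

lemma dlvl_eq:
  assumes c: "c \<in> Rec G s"
  shows "dlvl G s c = card (arcs G) - (card (verts G) - 1) - sum (stable_compl c) (verts G)"
proof -
  have "card (arcs G) = (\<Sum>v\<in>verts G. out_degree G v)"
  proof -
    have "{e \<in> arcs G. tail G e \<in> verts G} = arcs G" by auto
    then show ?thesis using card_fibers[OF finite_arcs finite_verts, of "tail G"]
      unfolding out_degree_def out_arcs_def by simp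
  qed
  also have "\<dots> = out_degree G s + (\<Sum>v\<in>nonsink. out_degree G v)"
    using s_in by (simp add: sum.remove)
  also have "(\<Sum>v\<in>nonsink. out_degree G v) = (\<Sum>v\<in>nonsink. c v + (1 + stable_compl c v))"
  proof (rule sum.cong[OF refl])
    fix v assume "v \<in> nonsink"
    then have "c v < out_degree G v" using c unfolding Rec_iff stable_def by blast
    then show "out_degree G v = c v + (1 + stable_compl c v)"
      using \<open>v \<in> nonsink\<close> unfolding stable_compl_def by simp
  qed
  also have "\<dots> = (\<Sum>v\<in>nonsink. c v) + (card nonsink + (\<Sum>v\<in>nonsink. stable_compl c v))"
    unfolding sum.distrib by simp
  also have "(\<Sum>v\<in>nonsink. stable_compl c v) = sum (stable_compl c) (verts G)"
    using s_in by (simp add: sum.remove stable_compl_def)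
  also have "card nonsink = card (verts G) - 1" using s_in by simp
  finally show ?thesis unfolding dlvl_def by simp
qed

lemma biggs_merino_poly_eq:
  "biggs_merino_poly G s = (\<Sum>p\<in>parking {s} (arcs G).
     monom 1 (card (arcs G) - (card (verts G) - 1) - sum p (verts G)))"
  unfolding biggs_merino_poly_eq_sum_Rec
  by (rule sum.reindex_bij_witness[of _ stable_compl stable_compl])
     (simp_all add: stable_compl_parking stable_compl_Rec dlvl_eq)

end


theorem theorem1p2:
  fixes G :: "('v, 'e) pre_digraph" and s :: 'v and r :: "'e rel"
  assumes "fin_digraph G"
    and "Digraph_Component.connected G"
    and "eulerian G"
    and "s \<in> verts G"
    and "linear_order_on (arcs G) r"
  shows "biggs_merino_poly G s = greedoid_tutte_poly r G s"
proof -
  interpret fin_digraph G by fact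
  interpret eulerian_sandpile G s by unfold_locales (use assms in auto)
  show ?thesis
    unfolding biggs_merino_poly_eq greedoid_tutte_poly_eq[OF assms(1,4,5)] ..
qed

end
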